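(* Let $N$ be a positive integer and let $0<p<\infty$ satisfy $Np>1$. Then the class $\mathfrak{R}_N(-i)$ of rational functions of the form $f(z)=(z-i)^{-N-1}P\big((z-i)^{-1}\big)$, where $P$ ranges over all polynomials with complex coefficients, is dense in the Hardy space $H^p(\mathbb{C}_{-1})$.
   Context: $\mathbb{C}_{-1}=\{z=x+iy: y<0\}$ is the lower half plane. For $0<p<\infty$, $H^p(\mathbb{C}_{-1})$ is the space of functions $f$ analytic in $\mathbb{C}_{-1}$ with $\|f\|_{H^p_{-1}}=\sup_{y<0}\left(\int_{-\infty}^{\infty}|f(x+iy)|^p\,dx\right)^{1/p}<\infty$. Density is with respect to the norm $\|\cdot\|_{H^p_{-1}}$ if $1\le p<\infty$, and with respect to the metric $d(f,g)=\sup_{y<0}\int_{-\infty}^\infty|f(x+iy)-g(x+iy)|^p\,dx$ if $0<p<1$. *)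

theory Defs
  imports "HOL-Complex_Analysis.Complex_Analysis"
begin

definition lower_half_plane :: "complex set" where
  "lower_half_plane = {z. Im z < 0}"

definition line_integral :: "real \<Rightarrow> (complex \<Rightarrow> complex) \<Rightarrow> real \<Rightarrow> real" where
  "line_integral p f y = (LINT x|lborel. norm (f (Complex x y)) powr p)"

(* Finiteness of the Hardy norm is spelled out as integrability on every
   horizontal line together with boundedness of the line norms, because real-valued
   integrals and suprema do not themselves record divergence.
   Elements are total functions of which only the restriction to the lower half
   plane matters; hardy_norm and hardy_dist below ignore all other values. *)
definition hardy_space :: "real \<Rightarrow> (complex \<Rightarrow> complex) set" where
  "hardy_space p = {f. f holomorphic_on lower_half_plane \<and>
     (\<forall>y<0. integrable lborel (\<lambda>x. norm (f (Complex x y)) powr p)) \<and>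
     bdd_above ((\<lambda>y. line_integral p f y powr (1 / p)) ` {..<0})}"

definition hardy_norm :: "real \<Rightarrow> (complex \<Rightarrow> complex) \<Rightarrow> real" where
  "hardy_norm p f = (SUP y\<in>{..<0}. line_integral p f y powr (1 / p))"

definition hardy_dist :: "real \<Rightarrow> (complex \<Rightarrow> complex) \<Rightarrow> (complex \<Rightarrow> complex) \<Rightarrow> real" where
  "hardy_dist p f g =
     (if 1 \<le> p then hardy_norm p (\<lambda>z. f z - g z)
      else (SUP y\<in>{..<0}. line_integral p (\<lambda>z. f z - g z) y))"

definition dense_in_hardy_space :: "real \<Rightarrow> (complex \<Rightarrow> complex) set \<Rightarrow> bool" where
  "dense_in_hardy_space p A \<longleftrightarrow> A \<subseteq> hardy_space p \<and>
     (\<forall>f\<in>hardy_space p. \<forall>\<epsilon>>0. \<exists>g\<in>A. hardy_dist p f g < \<epsilon>)"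

definition rational_class :: "nat \<Rightarrow> (complex \<Rightarrow> complex) set" where
  "rational_class N =
     {\<lambda>z. inverse (z - \<i>) ^ (N + 1) * poly P (inverse (z - \<i>)) | P. True}"

end

theory Submission
  imports Defs
begin

text \<open>
  Write \<open>I(F, y)\<close> for the integral of \<open>|F(x + i y)|\<^sup>p\<close> over \<open>x\<close>. The proof treats all exponents
  alike and uses neither boundary values nor maximal functions. It rests on one fact
  (\<open>line_mass_mono\<close>): if \<open>F\<close> is holomorphic and \<open>I(F, y)\<close> bounded, then \<open>I(F, y)\<close> is
  nondecreasing in \<open>y\<close>. The reason is that \<open>|F|\<^sup>p\<close> is subharmonic (\<open>norm_powr_le_circle_mean\<close>), so its
  integral over horizontal translations is a subharmonic function of \<open>y\<close> alone, hence convex, and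
  a bounded convex function on a half-line unbounded to the left is nondecreasing.

  Given \<open>f\<close> in the Hardy space, the approximation has three steps.

  \<^item> A small downward translate \<open>h(z) = f(z - i \<delta>)\<close> is close to \<open>f\<close> (\<open>translation_approx\<close>). This is an
    argument by uniform convexity: the norms of \<open>h\<close> do not exceed those of \<open>f\<close>, while the
    means \<open>(f + h) / 2\<close> and, in the exponent \<open>p / 2\<close>, the products \<open>f h\<close> have almost the norm of \<open>f\<close>
    as \<open>\<delta> \<rightarrow> 0\<close>. The pointwise inequality \<open>complex_powr_convexity\<close> turns this into smallness
    of \<open>I(f - h, y)\<close>. The products make it work for \<open>p \<le> 1\<close>, where the norm is not strictly
    convex. Since all the functions involved are holomorphic, monotonicity gives the
    estimate on every line at once.

  \<^item> Now \<open>h\<close> is bounded and holomorphic beyond the real line. Dividing it by \<open>(1 + i \<epsilon> z) ^ (N + 2)\<close>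
    changes it little for small \<open>\<epsilon>\<close> (\<open>damping_approx\<close>) and yields a function \<open>g\<close> that decays
    like \<open>|z| ^ -(N + 2)\<close>.

  \<^item> In the coordinate \<open>w = 1 + 2 i / (z - i)\<close> of the unit disc, \<open>(z - i) ^ (N + 1) g(z)\<close> is continuous
    on the closed disc and holomorphic inside, hence a uniform limit of polynomials in \<open>w\<close>,
    that is, in \<open>1 / (z - i)\<close> (\<open>rational_class_approx\<close>). A uniform error \<open>\<kappa>\<close> there is an error
    \<open>\<kappa> |z - i| ^ -(N + 1)\<close> for \<open>g\<close>, and this is small in the Hardy space because the
    exponent \<open>(N + 1) p\<close> is larger than \<open>1\<close>.
\<close>

section \<open>The sub-mean value property of powers of the modulus\<close>

text \<open>
  Without zeros, \<open>F\<close> has a logarithm, so \<open>|F|\<^sup>q\<close> is the modulus of a holomorphic function,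
  and the Cauchy integral over the circle bounds it for every real \<open>q\<close>. The crude bound
  \<open>r / (r - |w|)\<close> for the Cauchy kernel is exact at the centre, where it gives
  the sub-mean value inequality; away from the centre it provides majorants.
\<close>
lemma zerofree_norm_powr_le_circle_mean:
  fixes F :: "complex \<Rightarrow> complex"
  assumes hol: "F holomorphic_on ball 0 R" and nz: "\<And>z. z \<in> ball 0 R \<Longrightarrow> F z \<noteq> 0"
    and r: "r < R" and w: "norm w < r"
  shows "norm (F w) powr q
    \<le> r / (r - norm w) * (integral {0..2*pi} (\<lambda>t. norm (F (of_real r * cis t)) powr q) / (2*pi))"
proof -
  have r0: "0 < r" using w norm_ge_zero[of w] by linarith
  have "0 \<in> ball (0::complex) R" using r r0 by simp
  then obtain L where L: "L holomorphic_on ball 0 R" "\<And>z. z \<in> ball 0 R \<Longrightarrow> exp (L z) = F z"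
    using holomorphic_logarithm_exists[OF convex_ball open_ball hol nz] by metis
  define H where "H z = exp (of_real q * L z)" for z
  have Hhol: "H holomorphic_on ball 0 R"
    unfolding H_def by (intro holomorphic_intros L)
  have normH: "norm (H z) = norm (F z) powr q" if "z \<in> ball 0 R" for z
  proof -
    have "norm (F z) = exp (Re (L z))" using L(2)[OF that] by (metis norm_exp_eq_Re)
    then show ?thesis by (simp add: H_def powr_def)
  qed
  have sub: "cball 0 r \<subseteq> ball 0 R" using r by auto
  have "((\<lambda>u. H u / (u - w)) has_contour_integral (2 * of_real pi * \<i> * H w)) (circlepath 0 r)"
    using Cauchy_integral_circlepath_simple[of H 0 r w] holomorphic_on_subset[OF Hhol sub] w by simp
  then have hi: "((\<lambda>t. H (of_real r * cis t) / (of_real r * cis t - w) * of_real r * \<i> * cis t)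
      has_integral (2 * of_real pi * \<i> * H w)) {0..2*pi}"
    unfolding circlepath_def by (subst (asm) has_contour_integral_part_circlepath_iff) simp_all
  have mem: "of_real r * cis t \<in> ball 0 R" for t
    using r r0 by (simp add: norm_mult)
  have cont: "continuous_on {0..2*pi} (\<lambda>t. norm (F (of_real r * cis t)) powr q)"
  proof -
    have "continuous_on {0..2*pi} (\<lambda>t. F (of_real r * cis t))"
      by (rule continuous_on_compose2[OF holomorphic_on_imp_continuous_on[OF hol]])
         (use mem in \<open>auto intro!: continuous_intros\<close>)
    then show ?thesis
      by (intro continuous_on_powr continuous_intros) (use nz mem in auto)
  qed
  have "norm (integral {0..2*pi}
        (\<lambda>t. H (of_real r * cis t) / (of_real r * cis t - w) * of_real r * \<i> * cis t))
      \<le> integral {0..2*pi} (\<lambda>t. r / (r - norm w) * norm (F (of_real r * cis t)) powr q)"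
  proof (rule integral_norm_bound_integral)
    show "(\<lambda>t. r / (r - norm w) * norm (F (of_real r * cis t)) powr q) integrable_on {0..2*pi}"
      by (intro integrable_continuous_real continuous_intros cont)
    fix t assume "t \<in> {0..2*pi}"
    have "r - norm w \<le> norm (of_real r * cis t - w)"
      using norm_triangle_ineq2[of "of_real r * cis t" w] r0 by (simp add: norm_mult)
    then have "norm (H (of_real r * cis t)) * r / norm (of_real r * cis t - w)
        \<le> norm (H (of_real r * cis t)) * r / (r - norm w)"
      using w r0 by (intro divide_left_mono mult_nonneg_nonneg mult_pos_pos) auto
    then show "norm (H (of_real r * cis t) / (of_real r * cis t - w) * of_real r * \<i> * cis t)
        \<le> r / (r - norm w) * norm (F (of_real r * cis t)) powr q"
      using r0 normH[OF mem, of t] by (simp add: norm_mult norm_divide mult_ac)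
  qed (use hi in blast)
  then have le: "2 * pi * norm (H w)
      \<le> r / (r - norm w) * integral {0..2*pi} (\<lambda>t. norm (F (of_real r * cis t)) powr q)"
    unfolding integral_unique[OF hi] by (simp add: norm_mult)
  have "norm (H w) \<le> r / (r - norm w) * integral {0..2*pi} (\<lambda>t. norm (F (of_real r * cis t)) powr q) / (2*pi)"
    by (rule mult_imp_le_div_pos) (use le in \<open>simp_all add: mult_ac\<close>)
  moreover have "w \<in> ball 0 R" using w r by simp
  ultimately show ?thesis by (simp add: normH)
qed

text \<open>
  The factor is \<open>R (z - a)\<close> divided by the Blaschke factor of \<open>a\<close> on the disc of radius \<open>R\<close>.
\<close>
lemma norm_Blaschke_factor_le:
  fixes a z :: complex
  assumes "norm a < R" "norm z \<le> R"
  shows "R * norm (z - a) \<le> norm (of_real (R\<^sup>2) - cnj a * z)"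
    and "norm z = R \<Longrightarrow> norm (of_real (R\<^sup>2) - cnj a * z) = R * norm (z - a)"
    and "cnj a * z \<noteq> of_real (R\<^sup>2)"
proof -
  have R: "0 < R" using assms(1) norm_ge_zero[of a] by linarith
  have id: "(norm (of_real (R\<^sup>2) - cnj a * z))\<^sup>2 - (R * norm (z - a))\<^sup>2
      = (R\<^sup>2 - (norm z)\<^sup>2) * (R\<^sup>2 - (norm a)\<^sup>2)"
    by (simp add: power_mult_distrib cmod_power2, algebra)
  have "0 \<le> (R\<^sup>2 - (norm z)\<^sup>2) * (R\<^sup>2 - (norm a)\<^sup>2)"
    using assms by (intro mult_nonneg_nonneg) (auto simp: power_mono)
  with id have "(R * norm (z - a))\<^sup>2 \<le> (norm (of_real (R\<^sup>2) - cnj a * z))\<^sup>2" by simp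
  then show "R * norm (z - a) \<le> norm (of_real (R\<^sup>2) - cnj a * z)"
    by (rule power2_le_imp_le) simp
  show "norm (of_real (R\<^sup>2) - cnj a * z) = R * norm (z - a)" if "norm z = R"
  proof -
    have "(norm (of_real (R\<^sup>2) - cnj a * z))\<^sup>2 = (R * norm (z - a))\<^sup>2" using id that by simp
    then show ?thesis using R by (simp add: power2_eq_iff_nonneg)
  qed
  show "cnj a * z \<noteq> of_real (R\<^sup>2)"
  proof
    assume "cnj a * z = of_real (R\<^sup>2)"
    then have "norm a * norm z = R\<^sup>2" by (metis abs_power2 complex_mod_cnj norm_mult norm_of_real)
    moreover have "norm a * norm z \<le> norm a * R" using assms by (intro mult_left_mono) auto
    moreover have "norm a * R < R * R" using assms R by simp
    ultimately show False by (simp add: power2_eq_square)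
  qed
qed

lemma continuous_on_if_punctured:
  fixes f :: "'a :: t2_space \<Rightarrow> 'b :: topological_space"
  assumes "continuous_on (S - {a}) f" "continuous (at a within S) f"
  shows "continuous_on S f"
proof -
  have "continuous (at z within S) f" if z: "z \<in> S" for z
  proof (cases "z = a")
    case False
    then have "at z within S = at z within (S - {a})"
      by (intro at_within_nhd[of _ "- {a}"]) auto
    then show ?thesis using assms(1) z False by (simp add: continuous_on_eq_continuous_within)
  qed (use assms(2) in simp)
  then show ?thesis by (simp add: continuous_on_eq_continuous_within)
qed

text \<open>
  Dividing out the Blaschke factors of the finitely many zeros leaves the modulus on the circle
  unchanged and increases it inside. Only zeros in the open disc are removed; those on the circle
  itself remain and are avoided below by working on slightly smaller circles.
\<close>
lemma zerofree_majorant: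
  fixes F :: "complex \<Rightarrow> complex"
  assumes "finite {z \<in> ball 0 R. F z = 0}" "continuous_on (cball 0 R) F" "F holomorphic_on ball 0 R"
    and R: "0 < R"
  shows "\<exists>G. continuous_on (cball 0 R) G \<and> G holomorphic_on ball 0 R \<and>
      (\<forall>z\<in>ball 0 R. G z \<noteq> 0) \<and> (\<forall>z\<in>ball 0 R. norm (F z) \<le> norm (G z)) \<and>
      (\<forall>z\<in>sphere 0 R. norm (G z) = norm (F z))"
  using assms(1-3)
proof (induction "card {z \<in> ball 0 R. F z = 0}" arbitrary: F)
  case 0
  then have "\<forall>z\<in>ball 0 R. F z \<noteq> 0" by auto
  with 0 show ?case by (intro exI[of _ F]) auto
next
  case (Suc k)
  then obtain a where a: "a \<in> ball 0 R" "F a = 0"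
    by (metis (mono_tags, lifting) card_eq_0_iff ex_in_conv mem_Collect_eq nat.distinct(1))
  have na: "norm a < R" using a by simp
  have nonconst: "\<exists>w\<in>ball 0 R. F w \<noteq> 0"
  proof (rule ccontr)
    assume "\<not> ?thesis"
    then have "{z \<in> ball 0 R. F z = 0} = ball 0 R" by auto
    moreover have "infinite (ball (0::complex) R)"
      using R uncountable_ball[of R "0::complex"] countable_finite by blast
    ultimately show False using Suc.prems by simp
  qed
  define n where "n = nat (zorder F a)"
  define h where "h = zor_poly F a"
  from zorder_exist_zero[OF Suc.prems(3) open_ball connected_ball a(1) nonconst]
  obtain r where r: "0 < r" "cball a r \<subseteq> ball 0 R" "h holomorphic_on cball a r"
      "\<And>w. w \<in> cball a r \<Longrightarrow> F w = h w * (w - a) ^ n \<and> h w \<noteq> 0"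
    unfolding n_def h_def by blast
  have n: "0 < n" using r(4)[of a] a r(1) by (cases n) auto
  define g where "g z = (if z = a then h a else F z / (z - a) ^ n)" for z
  have Fg: "F z = g z * (z - a) ^ n" for z using a n by (simp add: g_def)
  have gh: "g z = h z" if "z \<in> ball a r" for z using r(4)[of z] that by (auto simp: g_def)
  have g1: "g holomorphic_on ball a r"
    using holomorphic_transform[of h "ball a r" g] gh holomorphic_on_subset[OF r(3)] by auto
  have "(\<lambda>z. F z / (z - a) ^ n) holomorphic_on (ball 0 R - {a})"
    by (intro holomorphic_intros holomorphic_on_subset[OF Suc.prems(3)]) auto
  then have g2: "g holomorphic_on (ball 0 R - {a})"
    by (rule holomorphic_transform) (auto simp: g_def)
  have "g holomorphic_on (ball a r \<union> (ball 0 R - {a}))"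
    by (rule holomorphic_on_Un[OF g1 g2]) (auto simp: open_Diff)
  then have ghol: "g holomorphic_on ball 0 R"
    by (rule holomorphic_on_subset) (use r in auto)
  have "continuous_on (cball 0 R - {a}) (\<lambda>z. F z / (z - a) ^ n)"
    by (intro continuous_intros continuous_on_subset[OF Suc.prems(2)]) auto
  then have "continuous_on (cball 0 R - {a}) g"
    by (rule continuous_on_eq) (auto simp: g_def)
  moreover have "continuous (at a) g" 
    using holomorphic_on_imp_continuous_on[OF ghol] a(1) by (simp add: continuous_on_eq_continuous_at)
  ultimately have gcont: "continuous_on (cball 0 R) g"
    using continuous_at_imp_continuous_at_within by (blast intro: continuous_on_if_punctured)
  \<comment> \<open>Trade the zero at \<open>a\<close> for a factor without zeros in the disc.\<close>
  define B where "B z = (of_real (R\<^sup>2) - cnj a * z) / of_real R" for z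
  define F1 where "F1 z = B z ^ n * g z" for z
  have B0: "B z \<noteq> 0" if "z \<in> cball 0 R" for z
    using norm_Blaschke_factor_le(3)[OF na, of z] that R by (simp add: B_def)
  have nB: "norm (z - a) \<le> norm (B z)" if "z \<in> cball 0 R" for z
    using norm_Blaschke_factor_le(1)[OF na, of z] that R by (simp add: B_def norm_divide field_simps)
  have nB': "norm (B z) = norm (z - a)" if "z \<in> sphere 0 R" for z
    using norm_Blaschke_factor_le(2)[OF na, of z] that R by (simp add: B_def norm_divide field_simps)
  have ga: "g a \<noteq> 0" using r(4)[of a] r(1) by (simp add: g_def)
  have zeros: "{z \<in> ball 0 R. F z = 0} = insert a {z \<in> ball 0 R. F1 z = 0}"
    using a B0 n ga by (auto simp: F1_def Fg)
  have "a \<notin> {z \<in> ball 0 R. F1 z = 0}" using a ga B0 by (simp add: F1_def)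
  moreover have fin: "finite {z \<in> ball 0 R. F1 z = 0}"
    using Suc.prems(1) unfolding zeros by simp
  ultimately have card: "k = card {z \<in> ball 0 R. F1 z = 0}"
    using Suc.hyps(2) unfolding zeros by simp
  have cont: "continuous_on (cball 0 R) F1" and hol: "F1 holomorphic_on ball 0 R"
    unfolding F1_def B_def using R by (auto intro!: continuous_intros holomorphic_intros gcont ghol)
  from Suc.hyps(1)[OF card fin cont hol] obtain G where G: "continuous_on (cball 0 R) G"
    "G holomorphic_on ball 0 R" "\<And>z. z \<in> ball 0 R \<Longrightarrow> G z \<noteq> 0"
    "\<And>z. z \<in> ball 0 R \<Longrightarrow> norm (F1 z) \<le> norm (G z)" "\<And>z. z \<in> sphere 0 R \<Longrightarrow> norm (G z) = norm (F1 z)"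
    by blast
  have "norm (F z) \<le> norm (G z)" if "z \<in> ball 0 R" for z
  proof -
    have "norm (F z) \<le> norm (F1 z)"
      unfolding Fg[of z] F1_def using nB[of z] that
      by (auto simp: norm_mult norm_power mult.commute intro!: mult_left_mono power_mono)
    then show ?thesis using G(4)[OF that] by simp
  qed
  moreover have "norm (G z) = norm (F z)" if "z \<in> sphere 0 R" for z
    using G(5)[OF that] nB'[OF that] unfolding F1_def Fg[of z]
    by (simp add: norm_mult norm_power)
  ultimately show ?case using G(1-3) by blast
qed

text \<open>
  The zero-free majorant satisfies the bound on every circle of radius \<open>r < R\<close>, and
  by continuity up to the boundary the bound survives \<open>r \<rightarrow> R\<close>, where majorant and function
  have the same modulus.
\<close>
lemma norm_powr_le_circle_mean:
  fixes F :: "complex \<Rightarrow> complex"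
  assumes hol: "F holomorphic_on ball z0 R1" and R: "R < R1" and q: "0 < q" and w: "norm w < R"
  shows "norm (F (z0 + w)) powr q \<le>
    R / (R - norm w) * (integral {0..2*pi} (\<lambda>t. norm (F (z0 + of_real R * cis t)) powr q) / (2*pi))"
proof (cases "F (z0 + w) = 0")
  case True
  have "0 \<le> integral {0..2*pi} (\<lambda>t. norm (F (z0 + of_real R * cis t)) powr q)"
    by (cases "(\<lambda>t. norm (F (z0 + of_real R * cis t)) powr q) integrable_on {0..2*pi}")
       (auto intro: integral_nonneg simp: not_integrable_integral)
  then show ?thesis using True w norm_ge_zero[of w]
    by (auto intro!: mult_nonneg_nonneg divide_nonneg_nonneg simp del: norm_ge_zero)
next
  case False
  have R0: "0 < R" using w norm_ge_zero[of w] by linarith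
  define E where "E z = F (z0 + z)" for z
  have "(F \<circ> (\<lambda>z. z0 + z)) holomorphic_on ball 0 R1"
    by (intro holomorphic_on_compose_gen[OF _ hol] holomorphic_intros) (auto simp: dist_norm)
  then have Ehol: "E holomorphic_on ball 0 R1" by (simp add: E_def[abs_def] o_def)
  have "finite {z \<in> cball 0 R. E z = 0}"
  proof (cases "E constant_on ball 0 R1")
    case True
    then have "\<forall>z \<in> ball 0 R1. E z \<noteq> 0"
      using False w R unfolding constant_on_def E_def
      by (metis (no_types, lifting) dist_0_norm mem_ball order.strict_trans)
    then show ?thesis using R by (auto intro: finite_subset[of _ "{}"])
  next
    case False
    show ?thesis
      by (rule holomorphic_compact_finite_zeros[OF Ehol open_ball connected_ball compact_cball _ False])
         (use R in auto)
  qed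
  then have fin: "finite {z \<in> ball 0 R. E z = 0}" by (rule finite_subset[rotated]) auto
  have Econt: "continuous_on (cball 0 R) E"
    using holomorphic_on_imp_continuous_on[OF Ehol] R by (auto elim: continuous_on_subset)
  have Ehol': "E holomorphic_on ball 0 R"
    using Ehol R by (auto elim: holomorphic_on_subset)
  from zerofree_majorant[OF fin Econt Ehol' R0] obtain G where
    G: "continuous_on (cball 0 R) G" "G holomorphic_on ball 0 R" "\<And>z. z \<in> ball 0 R \<Longrightarrow> G z \<noteq> 0"
       "\<And>z. z \<in> ball 0 R \<Longrightarrow> norm (E z) \<le> norm (G z)"
       "\<And>z. z \<in> sphere 0 R \<Longrightarrow> norm (G z) = norm (E z)"
    by blast
  define u where "u z = norm (G z) powr q" for z
  have ucont: "continuous_on (cball 0 R) u"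
    unfolding u_def using q by (intro continuous_on_powr' continuous_intros G) auto
  have "bdd_above (u ` cball 0 R)"
    by (intro bounded_imp_bdd_above compact_imp_bounded compact_continuous_image ucont compact_cball)
  then obtain B where B: "\<And>z. z \<in> cball 0 R \<Longrightarrow> u z \<le> B"
    unfolding bdd_above_def by blast
  \<comment> \<open>Radii increasing to \<open>R\<close> that exceed \<open>|w|\<close> from the start.\<close>
  define r where "r n = R - (R - norm w) / real (n + 2)" for n :: nat
  have r: "norm w < r n" "r n < R" for n
  proof -
    have "(R - norm w) / real (n + 2) < (R - norm w) / 1"
      using w by (intro divide_strict_left_mono) auto
    then show "norm w < r n" by (simp add: r_def)
    show "r n < R" using w by (simp add: r_def)
  qed
  have r0: "0 < r n" for n using r(1)[of n] norm_ge_zero[of w] by linarith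
  have rlim: "r \<longlonglongrightarrow> R" unfolding r_def by real_asymp
  have ucirc: "continuous_on {0..2*pi} (\<lambda>t. u (of_real s * cis t))" if "0 \<le> s" "s \<le> R" for s
    by (rule continuous_on_compose2[OF ucont]) (use that in \<open>auto intro!: continuous_intros simp: norm_mult\<close>)
  have lim: "(\<lambda>n. integral {0..2*pi} (\<lambda>t. u (of_real (r n) * cis t)))
      \<longlonglongrightarrow> integral {0..2*pi} (\<lambda>t. u (of_real R * cis t))"
  proof (rule dominated_convergence(2))
    show "(\<lambda>t. u (of_real (r n) * cis t)) integrable_on {0..2*pi}" for n
      using r(2)[of n] r0[of n] by (intro integrable_continuous_real ucirc) auto
    show "(\<lambda>t. B) integrable_on {0..2*pi}" by (intro integrable_continuous_real continuous_intros)
    show "norm (u (of_real (r n) * cis t)) \<le> B" if "t \<in> {0..2*pi}" for n t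
      using B[of "of_real (r n) * cis t"] r(2)[of n] r0[of n] by (simp add: norm_mult u_def)
    show "(\<lambda>n. u (of_real (r n) * cis t)) \<longlonglongrightarrow> u (of_real R * cis t)" for t
    proof -
      have "(\<lambda>n. of_real (r n) * cis t) \<longlonglongrightarrow> of_real R * cis t"
        by (intro tendsto_intros rlim)
      then show ?thesis
        using ucont R0 less_imp_le[OF r(2)] less_imp_le[OF r0]
        by (auto intro: continuous_on_tendsto_compose[OF ucont] simp: norm_mult)
    qed
  qed
  have "norm (G w) powr q \<le>
      R / (R - norm w) * (integral {0..2*pi} (\<lambda>t. u (of_real R * cis t)) / (2*pi))"
  proof (rule LIMSEQ_le_const)
    show "(\<lambda>n. r n / (r n - norm w) * (integral {0..2*pi} (\<lambda>t. u (of_real (r n) * cis t)) / (2*pi)))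
      \<longlonglongrightarrow> R / (R - norm w) * (integral {0..2*pi} (\<lambda>t. u (of_real R * cis t)) / (2*pi))"
      by (intro tendsto_intros rlim lim) (use w in auto)
    show "\<exists>N. \<forall>n\<ge>N. norm (G w) powr q \<le>
        r n / (r n - norm w) * (integral {0..2*pi} (\<lambda>t. u (of_real (r n) * cis t)) / (2*pi))"
      using zerofree_norm_powr_le_circle_mean[OF G(2,3) r(2,1)] by (auto simp: u_def)
  qed
  moreover have "norm (E w) powr q \<le> norm (G w) powr q"
    using G(4)[of w] w q by (intro powr_mono2) auto
  moreover have "u (of_real R * cis t) = norm (F (z0 + of_real R * cis t)) powr q" for t
    using G(5)[of "of_real R * cis t"] R0 by (simp add: u_def E_def norm_mult)
  ultimately show ?thesis by (simp add: E_def)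
qed

section \<open>Integrals over horizontal lines\<close>

lemma add_mult_sin_le: "0 \<le> r \<Longrightarrow> y + r * sin t \<le> y + (r :: real)"
  using mult_left_mono[OF sin_le_one[of t], of r] by simp

text \<open>
  The mean over \<open>t\<close> of \<open>M (y + r sin t)\<close> is the circle mean of the function \<open>x + i y \<mapsto> M y\<close>, so the
  hypothesis says that this function is subharmonic, which for a function of \<open>y\<close> alone means
  that \<open>M\<close> is convex; and a convex function bounded above near \<open>-\<infinity>\<close> cannot decrease.
  Instead of passing through convexity, the proof applies the maximum principle to
  \<open>M\<close> plus a small linear function, which is harmonic and makes the supremum over
  a half-line attained.
\<close>
lemma bounded_above_submean_imp_mono:
  fixes M :: "real \<Rightarrow> real"
  assumes cont: "continuous_on {..<c} M" and bound: "\<And>y. y < c \<Longrightarrow> M y \<le> K"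
    and submean: "\<And>y r. 0 < r \<Longrightarrow> y + r < c \<Longrightarrow> M y \<le> integral {0..2*pi} (\<lambda>t. M (y + r * sin t)) / (2*pi)"
    and le: "y1 \<le> y2" and c: "y2 < c"
  shows "M y1 \<le> M y2"
proof (rule ccontr)
  assume "\<not> M y1 \<le> M y2"
  then have gt: "M y2 < M y1" by simp
  then have lt: "y1 < y2" using le by (cases "y1 = y2") auto
  define e where "e = (M y1 - M y2) / (2 * (y2 - y1))"
  have e: "0 < e" using gt lt by (simp add: e_def)
  define N where "N y = M y + e * (y - y2)" for y
  have Ny1: "N y2 < N y1"
  proof -
    have "e * (y1 - y2) = - (M y1 - M y2) / 2" using lt by (simp add: e_def field_simps)
    then show ?thesis using gt by (simp add: N_def)
  qed
  have Ncont: "continuous_on {..<c} N" unfolding N_def by (intro continuous_intros cont)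
  \<comment> \<open>Below \<open>y2 - L\<close>, the linear term pushes \<open>N\<close> under \<open>N y2\<close>.\<close>
  define L where "L = max (y2 - y1) ((K - M y2) / e)"
  have L: "y2 - y1 \<le> L" "K - M y2 \<le> e * L"
  proof -
    have "(K - M y2) / e \<le> L" by (simp add: L_def)
    then show "K - M y2 \<le> e * L" using e by (simp add: pos_divide_le_eq mult.commute)
  qed (simp add: L_def)
  obtain s where s: "s \<in> {y2 - L..y2}" "\<And>y. y \<in> {y2 - L..y2} \<Longrightarrow> N y \<le> N s"
    using continuous_attains_sup[of "{y2 - L..y2}" N] continuous_on_subset[OF Ncont, of "{y2 - L..y2}"]
      L(1) lt c by force
  have Ns: "N y1 \<le> N s" using s(2)[of y1] L(1) lt by simp
  have max: "N y \<le> N s" if "y \<le> y2" for y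
  proof (cases "y2 - L \<le> y")
    case True
    then show ?thesis using s(2) that by simp
  next
    case False
    then have "e * (y - y2) \<le> e * (- L)" using e by (intro mult_left_mono) auto
    moreover have "M y \<le> K" using bound that c by simp
    ultimately have "N y \<le> N y2" using L(2) by (simp add: N_def)
    then show ?thesis using Ny1 Ns by simp
  qed
  \<comment> \<open>The circle around the maximum point that touches \<open>y2\<close>, where \<open>N\<close> is strictly smaller.\<close>
  define r where "r = y2 - s"
  have r: "0 < r" using Ny1 Ns s(1) by (cases "s = y2") (auto simp: r_def)
  have below: "s + r * sin t \<le> y2" for t
    using add_mult_sin_le[of r s t] r by (simp add: r_def)
  have contM: "continuous_on {0..2*pi} (\<lambda>t. M (s + r * sin t))"
    by (rule continuous_on_compose2[OF cont])
       (use le_less_trans[OF below c] in \<open>auto intro!: continuous_intros\<close>)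
  have sin0: "(sin has_integral 0) {0..2*pi}"
  proof -
    have "(sin has_integral (- cos (2*pi) - - cos 0)) {0..2*pi}"
      by (rule fundamental_theorem_of_calculus)
         (auto intro!: derivative_eq_intros simp: has_real_derivative_iff_has_vector_derivative[symmetric])
    then show ?thesis by simp
  qed
  have "((\<lambda>t. N s - (M (s + r * sin t) + e * (s - y2) + e * r * sin t)) has_integral
      (2*pi * N s - (integral {0..2*pi} (\<lambda>t. M (s + r * sin t)) + 2*pi * (e * (s - y2)) + e * r * 0))) {0..2*pi}"
    by (intro has_integral_diff has_integral_add has_integral_mult_right sin0
        integrable_integral integrable_continuous_real contM)
       (use has_integral_const_real[of "N s" 0 "2*pi"]
          has_integral_const_real[of "e * (s - y2)" 0 "2*pi"] in \<open>simp_all add: mult.assoc\<close>)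
  moreover have "N s - (M (s + r * sin t) + e * (s - y2) + e * r * sin t) = N s - N (s + r * sin t)" for t
    by (simp add: N_def algebra_simps)
  ultimately have int: "integral {0..2*pi} (\<lambda>t. N s - N (s + r * sin t))
      = 2*pi * M s - integral {0..2*pi} (\<lambda>t. M (s + r * sin t))"
    by (simp add: N_def has_integral_iff algebra_simps)
  have "M s \<le> integral {0..2*pi} (\<lambda>t. M (s + r * sin t)) / (2*pi)"
    using submean[of r s] r c by (simp add: r_def)
  then have "integral {0..2*pi} (\<lambda>t. N s - N (s + r * sin t)) \<le> 0"
    unfolding int by (simp add: field_simps)
  moreover have ge: "0 \<le> N s - N (s + r * sin t)" for t using max below by simp
  then have "0 \<le> integral {0..2*pi} (\<lambda>t. N s - N (s + r * sin t))"
    by (metis integral_nonneg not_integrable_integral order_refl)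
  moreover have "continuous_on {0..2*pi} (\<lambda>t. N s - N (s + r * sin t))"
    unfolding N_def by (intro continuous_intros contM)
  ultimately have "\<forall>t\<in>{0..2*pi}. N s - N (s + r * sin t) = 0"
    using integral_eq_0_iff[of 0 "2*pi" "\<lambda>t. N s - N (s + r * sin t)"] ge by auto
  then have "N s - N (s + r * sin (pi/2)) = 0"
    by (rule bspec) (use pi_gt_zero in auto)
  then show False using Ny1 Ns by (simp add: r_def)
qed

text \<open>
  The values are extended reals, so that a bound on them includes integrability, and Tonelli
  and Fatou apply without side conditions.
\<close>
definition line_mass :: "real \<Rightarrow> (complex \<Rightarrow> complex) \<Rightarrow> real \<Rightarrow> ennreal" where
  "line_mass q F y = (\<integral>\<^sup>+x. ennreal (norm (F (Complex x y)) powr q) \<partial>lborel)"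

definition circle_mass :: "real \<Rightarrow> (complex \<Rightarrow> complex) \<Rightarrow> real \<Rightarrow> complex \<Rightarrow> ennreal" where
  "circle_mass q F R z0 =
     (\<integral>\<^sup>+t. ennreal (indicator {0..2*pi} t * norm (F (z0 + of_real R * cis t)) powr q) \<partial>lborel)"

lemma ball_subset_half_plane: "Im z + r \<le> c \<Longrightarrow> ball z r \<subseteq> {z. Im z < c}"
proof
  fix w assume "Im z + r \<le> c" "w \<in> ball z r"
  then show "w \<in> {z. Im z < c}"
    using abs_Im_le_cmod[of "w - z"] by (simp add: dist_norm norm_minus_commute)
qed

lemma continuous_on_norm_powr:
  "continuous_on A F \<Longrightarrow> 0 < q \<Longrightarrow> continuous_on A (\<lambda>x. norm (F x) powr q)"
  by (intro continuous_on_powr' continuous_intros) auto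

lemma continuous_on_half_plane_compose:
  assumes "F holomorphic_on {z. Im z < c}" "continuous_on A f" "continuous_on A g"
    "\<And>x. x \<in> A \<Longrightarrow> g x < c"
  shows "continuous_on A (\<lambda>x. F (Complex (f x) (g x)))"
  unfolding Complex_eq
  by (rule continuous_on_compose2[OF holomorphic_on_imp_continuous_on[OF assms(1)]])
     (use assms in \<open>auto intro!: continuous_intros\<close>)

lemma measurable_line:
  assumes "F holomorphic_on {z. Im z < c}" "0 < q" "y < c"
  shows "(\<lambda>x. norm (F (Complex x y)) powr q) \<in> borel_measurable borel"
  using assms
  by (intro borel_measurable_continuous_onI continuous_on_norm_powr continuous_on_half_plane_compose) auto

text \<open>
  The bound on circles in a form fit for integration over the centre \<open>z0\<close>.
\<close>
lemma norm_powr_le_circle_mass: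
  assumes hol: "F holomorphic_on {z. Im z < c}" and q: "0 < q" and R: "Im z0 + R < c" and w: "norm w < R"
  shows "ennreal (norm (F (z0 + w)) powr q) \<le> ennreal (R / (R - norm w) / (2*pi)) * circle_mass q F R z0"
proof -
  define R1 where "R1 = c - Im z0"
  have R1: "R < R1" using R by (simp add: R1_def)
  have R0: "0 < R" using w norm_ge_zero[of w] by linarith
  have hol1: "F holomorphic_on ball z0 R1"
    by (rule holomorphic_on_subset[OF hol ball_subset_half_plane]) (simp add: R1_def)
  have cont: "continuous_on {0..2*pi} (\<lambda>t. norm (F (z0 + of_real R * cis t)) powr q)"
    by (intro continuous_on_norm_powr q continuous_on_compose2[OF holomorphic_on_imp_continuous_on[OF hol1]])
       (use R1 R0 in \<open>auto intro!: continuous_intros simp: dist_norm norm_mult\<close>)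
  let ?I = "integral {0..2*pi} (\<lambda>t. norm (F (z0 + of_real R * cis t)) powr q)"
  have "circle_mass q F R z0 = ennreal ?I"
    unfolding circle_mass_def
    by (intro nn_integral_has_integral_lebesgue integrable_integral integrable_continuous_real cont) auto
  moreover have "0 \<le> ?I" by (intro integral_nonneg integrable_continuous_real cont) auto
  moreover have "norm (F (z0 + w)) powr q \<le> R / (R - norm w) / (2*pi) * ?I"
    using norm_powr_le_circle_mean[OF hol1 R1 q w] by simp
  ultimately show ?thesis
    using w R0 by (simp add: ennreal_mult'[symmetric] ennreal_leI)
qed

lemma measurable_circle:
  assumes "F holomorphic_on {z. Im z < c}" "0 < q" "y + R < c" "0 \<le> R"
  shows "(\<lambda>(x, t). ennreal (indicator {0..2*pi} t * norm (F (Complex x y + of_real R * cis t)) powr q))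
      \<in> borel_measurable (lborel \<Otimes>\<^sub>M lborel)"
proof -
  have eq: "Complex x y + of_real R * cis t = Complex (x + R * cos t) (y + R * sin t)" for x t
    by (simp add: complex_eq_iff)
  have "y + R * sin t < c" for t
    using assms add_mult_sin_le[of R y t] by linarith
  then have "continuous_on UNIV (\<lambda>p. norm (F (Complex (fst p) y + of_real R * cis (snd p))) powr q)"
    unfolding eq using assms
    by (intro continuous_on_norm_powr continuous_on_half_plane_compose[OF assms(1)] continuous_intros) auto
  then have m[measurable]: "(\<lambda>p. norm (F (Complex (fst p) y + of_real R * cis (snd p))) powr q)
      \<in> borel_measurable (borel \<Otimes>\<^sub>M borel)"
    unfolding borel_prod by (rule borel_measurable_continuous_onI)
  have "(\<lambda>p. ennreal (indicator {0..2*pi} (snd p) * norm (F (Complex (fst p) y + of_real R * cis (snd p))) powr q))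
      \<in> borel_measurable (borel \<Otimes>\<^sub>M borel)"
    by measurable
  moreover have "sets (lborel \<Otimes>\<^sub>M lborel) = sets (borel \<Otimes>\<^sub>M (borel :: real measure) :: (real \<times> real) measure)"
    by (intro sets_pair_measure_cong) auto
  ultimately show ?thesis
    by (simp add: split_beta' cong: measurable_cong_sets)
qed

lemma measurable_circle_mass:
  assumes "F holomorphic_on {z. Im z < c}" "0 < q" "y + R < c" "0 \<le> R"
  shows "(\<lambda>x. circle_mass q F R (Complex x y)) \<in> borel_measurable lborel"
  unfolding circle_mass_def
  using lborel.borel_measurable_nn_integral_fst[OF measurable_circle[OF assms]] by simp

text \<open>
  Tonelli's theorem and translation invariance: when the centre runs through a horizontal line,
  each point of the circle sweeps out the horizontal line at its own height.
\<close>
lemma nn_integral_circle_mass: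
  assumes hol: "F holomorphic_on {z. Im z < c}" and q: "0 < q" and R: "y + R < c" "0 \<le> R"
  shows "(\<integral>\<^sup>+x. circle_mass q F R (Complex x y) \<partial>lborel)
      = (\<integral>\<^sup>+t. indicator {0..2*pi} t * line_mass q F (y + R * sin t) \<partial>lborel)"
proof -
  have below: "y + R * sin t < c" for t
    using R add_mult_sin_le[of R y t] by linarith
  have eq: "Complex x y + of_real R * cis t = Complex (R * cos t + 1 * x) (y + R * sin t)" for x t
    by (simp add: complex_eq_iff)
  have "(\<integral>\<^sup>+x. circle_mass q F R (Complex x y) \<partial>lborel)
      = (\<integral>\<^sup>+t. (\<integral>\<^sup>+x. ennreal (indicator {0..2*pi} t * norm (F (Complex x y + of_real R * cis t)) powr q) \<partial>lborel) \<partial>lborel)"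
    unfolding circle_mass_def
    by (rule lborel_pair.Fubini'[symmetric]) (rule measurable_circle[OF assms])
  also have "\<dots> = (\<integral>\<^sup>+t. indicator {0..2*pi} t * line_mass q F (y + R * sin t) \<partial>lborel)"
  proof (rule nn_integral_cong)
    fix t :: real
    have m[measurable]: "(\<lambda>x. norm (F (Complex x (y + R * sin t))) powr q) \<in> borel_measurable borel"
      by (rule measurable_line[OF hol q below])
    have "line_mass q F (y + R * sin t)
        = (\<integral>\<^sup>+x. ennreal (norm (F (Complex (R * cos t + 1 * x) (y + R * sin t))) powr q) \<partial>lborel)"
      unfolding line_mass_def by (subst nn_integral_real_affine[where t = "R * cos t" and c = 1]) auto
    then show "(\<integral>\<^sup>+x. ennreal (indicator {0..2*pi} t * norm (F (Complex x y + of_real R * cis t)) powr q) \<partial>lborel)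
        = indicator {0..2*pi} t * line_mass q F (y + R * sin t)"
      unfolding eq by (cases "t \<in> {0..2*pi}") auto
  qed
  finally show ?thesis .
qed

lemma nn_integral_circle_mass_le:
  assumes hol: "F holomorphic_on {z. Im z < c}" and q: "0 < q" and R: "y + R < c" "0 \<le> R"
    and K: "\<And>y. y < c \<Longrightarrow> line_mass q F y \<le> ennreal K"
  shows "(\<integral>\<^sup>+x. circle_mass q F R (Complex x y) \<partial>lborel) \<le> ennreal (2*pi) * ennreal K"
proof -
  have below: "y + R * sin t < c" for t
    using R add_mult_sin_le[of R y t] by linarith
  have "(\<integral>\<^sup>+x. circle_mass q F R (Complex x y) \<partial>lborel)
      \<le> (\<integral>\<^sup>+t. ennreal K * indicator {0..2*pi} t \<partial>lborel)"
    unfolding nn_integral_circle_mass[OF hol q R]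
    by (intro nn_integral_mono) (use K below in \<open>auto split: split_indicator\<close>)
  also have "\<dots> = ennreal (2*pi) * ennreal K"
    by (simp add: nn_integral_cmult_indicator mult.commute)
  finally show ?thesis .
qed

text \<open>
  Subharmonicity alone gives no continuity here. The bound on circles around the points \<open>x + i y\<close>
  majorises \<open>|F|\<^sup>q\<close> simultaneously on all nearby lines by one function of \<open>x\<close>,
  which is integrable by Tonelli; dominated convergence does the rest.
\<close>
lemma continuous_on_line_mass:
  assumes hol: "F holomorphic_on {z. Im z < c}" and q: "0 < q"
    and K: "\<And>y. y < c \<Longrightarrow> line_mass q F y \<le> ennreal K"
  shows "continuous_on {..<c} (line_mass q F)"
proof (rule continuous_on_sequentiallyI)
  fix s :: "nat \<Rightarrow> real" and y assume s: "\<forall>n. s n \<in> {..<c}" "y \<in> {..<c}" "s \<longlonglongrightarrow> y"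
  define R where "R = (c - y) / 2"
  have R: "0 < R" "y + R < c" using s(2) by (auto simp: R_def field_simps)
  obtain n0 where n0: "\<And>n. n \<ge> n0 \<Longrightarrow> \<bar>s n - y\<bar> < R / 2"
    using LIMSEQ_D[OF s(3), of "R / 2"] R by auto
  have "(\<lambda>n. line_mass q F (s (n + n0))) \<longlonglongrightarrow> line_mass q F y"
    unfolding line_mass_def
  proof (rule nn_integral_dominated_convergence)
    show "(\<lambda>x. ennreal (norm (F (Complex x (s (n + n0)))) powr q)) \<in> borel_measurable lborel" for n
      using measurable_line[OF hol q, of "s (n + n0)"] s(1) by simp
    show "(\<lambda>x. ennreal (norm (F (Complex x y)) powr q)) \<in> borel_measurable lborel"
      using measurable_line[OF hol q, of y] s(2) by simp
    show "(\<lambda>x. ennreal (1 / pi) * circle_mass q F R (Complex x y)) \<in> borel_measurable lborel"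
      using measurable_circle_mass[OF hol q R(2)] R(1) by simp
    show "AE x in lborel. ennreal (norm (F (Complex x (s (n + n0)))) powr q)
        \<le> ennreal (1 / pi) * circle_mass q F R (Complex x y)" for n
    proof (rule AE_I2)
      fix x
      define w where "w = Complex 0 (s (n + n0) - y)"
      have w: "norm w < R / 2" using n0[of "n + n0"] by (simp add: w_def cmod_def)
      have "R / (R - norm w) / (2*pi) \<le> 1 / pi"
        using w R by (simp add: field_simps)
      then have "ennreal (R / (R - norm w) / (2*pi)) * circle_mass q F R (Complex x y)
          \<le> ennreal (1 / pi) * circle_mass q F R (Complex x y)"
        by (intro mult_right_mono ennreal_leI) auto
      moreover have "Complex x (s (n + n0)) = Complex x y + w" by (simp add: w_def complex_eq_iff)
      ultimately show "ennreal (norm (F (Complex x (s (n + n0)))) powr q)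
        \<le> ennreal (1 / pi) * circle_mass q F R (Complex x y)"
        using norm_powr_le_circle_mass[OF hol q, of "Complex x y" R w] R w by (auto intro: order_trans)
    qed
    have "(\<integral>\<^sup>+x. ennreal (1 / pi) * circle_mass q F R (Complex x y) \<partial>lborel)
        = ennreal (1 / pi) * (\<integral>\<^sup>+x. circle_mass q F R (Complex x y) \<partial>lborel)"
      using measurable_circle_mass[OF hol q R(2)] R(1) by (intro nn_integral_cmult) simp
    also have "\<dots> \<le> ennreal (1 / pi) * (ennreal (2*pi) * ennreal K)"
      using nn_integral_circle_mass_le[OF hol q R(2) _ K] R(1) by (intro mult_left_mono) auto
    also have "\<dots> < \<infinity>" by (simp add: ennreal_mult_less_top)
    finally show "(\<integral>\<^sup>+x. ennreal (1 / pi) * circle_mass q F R (Complex x y) \<partial>lborel) < \<infinity>" .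
    show "AE x in lborel. (\<lambda>n. ennreal (norm (F (Complex x (s (n + n0)))) powr q))
        \<longlonglongrightarrow> ennreal (norm (F (Complex x y)) powr q)"
    proof (rule AE_I2)
      fix x
      have "continuous_on {..<c} (\<lambda>y. norm (F (Complex x y)) powr q)"
        by (intro continuous_on_norm_powr q continuous_on_half_plane_compose[OF hol] continuous_intros) auto
      then have "(\<lambda>n. norm (F (Complex x (s (n + n0)))) powr q) \<longlonglongrightarrow> norm (F (Complex x y)) powr q"
        by (rule continuous_on_tendsto_compose) (use s LIMSEQ_ignore_initial_segment in auto)
      then show "(\<lambda>n. ennreal (norm (F (Complex x (s (n + n0)))) powr q))
        \<longlonglongrightarrow> ennreal (norm (F (Complex x y)) powr q)" by (rule tendsto_ennrealI)
    qed
  qed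
  then show "(\<lambda>n. line_mass q F (s n)) \<longlonglongrightarrow> line_mass q F y" by (rule LIMSEQ_offset)
qed

text \<open>
  This replaces boundary values and Poisson integrals in all that follows: suprema over the
  half plane can be computed on lines close to its boundary.
\<close>
lemma line_mass_mono:
  assumes hol: "F holomorphic_on {z. Im z < c}" and q: "0 < q"
    and K: "\<And>y. y < c \<Longrightarrow> line_mass q F y \<le> ennreal K" and le: "y1 \<le> y2" "y2 < c"
  shows "line_mass q F y1 \<le> line_mass q F y2"
proof -
  define M where "M y = enn2real (line_mass q F y)" for y
  have fin: "line_mass q F y < top" if "y < c" for y
    using K[OF that] by (simp add: order_le_less_trans)
  have LM: "line_mass q F y = ennreal (M y)" if "y < c" for y
    using fin[OF that] by (simp add: M_def)
  have Mcont: "continuous_on {..<c} M"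
    unfolding continuous_on_def
  proof
    fix y assume y: "y \<in> {..<c}"
    then have yc: "y < c" by simp
    have "(line_mass q F \<longlongrightarrow> line_mass q F y) (at y within {..<c})"
      using continuous_on_line_mass[OF hol q K] y unfolding continuous_on_def by blast
    then have "(line_mass q F \<longlongrightarrow> ennreal (M y)) (at y within {..<c})"
      unfolding LM[OF yc] .
    then have "((\<lambda>y. enn2real (line_mass q F y)) \<longlongrightarrow> M y) (at y within {..<c})"
      by (rule tendsto_enn2real) (simp add: M_def)
    then show "(M \<longlongrightarrow> M y) (at y within {..<c})" by (simp add: M_def[abs_def])
  qed
  have "M y1 \<le> M y2"
  proof (rule bounded_above_submean_imp_mono[OF Mcont _ _ le])
    show "M y \<le> max K 0" if "y < c" for y
    proof -
      have "ennreal (M y) \<le> ennreal (max K 0)"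
        using K[OF that] unfolding LM[OF that] by (rule order_trans) (simp add: ennreal_leI)
      then show ?thesis by (simp add: ennreal_le_iff)
    qed
    fix y r :: real assume r: "0 < r" "y + r < c"
    have y: "y < c" using r by simp
    have below: "y + r * sin t < c" for t
      using r add_mult_sin_le[of r y t] by linarith
    have cont: "continuous_on {0..2*pi} (\<lambda>t. M (y + r * sin t))"
      by (rule continuous_on_compose2[OF Mcont]) (use below in \<open>auto intro!: continuous_intros\<close>)
    let ?I = "integral {0..2*pi} (\<lambda>t. M (y + r * sin t))"
    have "ennreal (M y) \<le> (\<integral>\<^sup>+x. ennreal (1 / (2*pi)) * circle_mass q F r (Complex x y) \<partial>lborel)"
      unfolding LM[OF y, symmetric] line_mass_def
    proof (rule nn_integral_mono)
      fix x
      show "ennreal (norm (F (Complex x y)) powr q)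
          \<le> ennreal (1 / (2*pi)) * circle_mass q F r (Complex x y)"
        using norm_powr_le_circle_mass[OF hol q, of "Complex x y" r 0] r by simp
    qed
    also have "\<dots> = ennreal (1 / (2*pi)) * (\<integral>\<^sup>+x. circle_mass q F r (Complex x y) \<partial>lborel)"
      using measurable_circle_mass[OF hol q r(2)] r(1) by (intro nn_integral_cmult) simp
    also have "(\<integral>\<^sup>+x. circle_mass q F r (Complex x y) \<partial>lborel)
        = (\<integral>\<^sup>+t. ennreal (indicator {0..2*pi} t * M (y + r * sin t)) \<partial>lborel)"
      unfolding nn_integral_circle_mass[OF hol q r(2) less_imp_le[OF r(1)]]
      by (intro nn_integral_cong) (auto simp: LM[OF below] split: split_indicator)
    also have "\<dots> = ennreal ?I"
      by (intro nn_integral_has_integral_lebesgue integrable_integral integrable_continuous_real cont)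
         (auto simp: M_def)
    finally have le: "ennreal (M y) \<le> ennreal (1 / (2*pi)) * ennreal ?I" .
    have I: "0 \<le> ?I"
      by (intro integral_nonneg integrable_continuous_real cont) (simp add: M_def)
    then have "ennreal (M y) \<le> ennreal (?I / (2*pi))"
      using le by (simp add: ennreal_mult'[symmetric])
    then show "M y \<le> ?I / (2*pi)"
      by (subst (asm) ennreal_le_iff) (use I in auto)
  qed
  then show ?thesis using LM le by (simp add: ennreal_leI)
qed

text \<open>
  The bound on circles, averaged over the horizontal translates of the circle that keep \<open>z\<close> well inside.
\<close>
lemma bounded_on_smaller_half_plane:
  assumes hol: "F holomorphic_on {z. Im z < c}" and q: "0 < q"
    and K: "\<And>y. y < c \<Longrightarrow> line_mass q F y \<le> ennreal K" and "d < c"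
  shows "\<exists>B. \<forall>z. Im z \<le> d \<longrightarrow> norm (F z) \<le> B"
proof -
  define R where "R = (c - d) / 2"
  have R: "0 < R" "d + R < c" using \<open>d < c\<close> by (auto simp: R_def field_simps)
  define B where "B = (2 / R * max K 0) powr (1 / q)"
  have "norm (F z) \<le> B" if z: "Im z \<le> d" for z
  proof -
    have yc: "Im z + R < c" using z R by simp
    have "ennreal (R * norm (F z) powr q)
        = (\<integral>\<^sup>+x. ennreal (norm (F z) powr q) * indicator {Re z - R/2 .. Re z + R/2} x \<partial>lborel)"
      using R by (simp add: nn_integral_cmult_indicator ennreal_mult'[symmetric] mult.commute)
    also have "\<dots> \<le> (\<integral>\<^sup>+x. ennreal (1 / pi) * circle_mass q F R (Complex x (Im z)) \<partial>lborel)"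
    proof (rule nn_integral_mono)
      fix x
      show "ennreal (norm (F z) powr q) * indicator {Re z - R/2 .. Re z + R/2} x
          \<le> ennreal (1 / pi) * circle_mass q F R (Complex x (Im z))"
      proof (cases "x \<in> {Re z - R/2 .. Re z + R/2}")
        case True
        define w :: complex where "w = of_real (Re z - x)"
        have w: "norm w \<le> R / 2" using True by (auto simp: w_def abs_if simp del: of_real_diff)
        have "R / (R - norm w) / (2*pi) \<le> 1 / pi" using w R by (simp add: field_simps)
        then have "ennreal (R / (R - norm w) / (2*pi)) * circle_mass q F R (Complex x (Im z))
            \<le> ennreal (1 / pi) * circle_mass q F R (Complex x (Im z))"
          by (intro mult_right_mono ennreal_leI) auto
        moreover have "Complex x (Im z) + w = z" by (simp add: w_def complex_eq_iff)
        ultimately show ?thesis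
          using norm_powr_le_circle_mass[OF hol q, of "Complex x (Im z)" R w] R w yc True
          by (auto intro: order_trans)
      qed simp
    qed
    also have "\<dots> = ennreal (1 / pi) * (\<integral>\<^sup>+x. circle_mass q F R (Complex x (Im z)) \<partial>lborel)"
      using measurable_circle_mass[OF hol q yc] R(1) by (intro nn_integral_cmult) simp
    also have "\<dots> \<le> ennreal (1 / pi) * (ennreal (2*pi) * ennreal (max K 0))"
      using nn_integral_circle_mass_le[OF hol q yc _ K] R(1)
      by (intro mult_left_mono) (auto simp: max_def ennreal_neg split: if_splits)
    also have "\<dots> = ennreal (2 * max K 0)"
      by (simp add: ennreal_mult'[symmetric] mult.assoc[symmetric])
    finally have "norm (F z) powr q \<le> 2 / R * max K 0"
      using R by (simp add: field_simps ennreal_le_iff)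
    then have "(norm (F z) powr q) powr (1 / q) \<le> B"
      unfolding B_def using q by (intro powr_mono2) auto
    then show ?thesis using q by (simp add: powr_powr)
  qed
  then show ?thesis by blast
qed

section \<open>Strong continuity of vertical translations\<close>

text \<open>
  A substitute for uniform convexity that works for all \<open>p > 0\<close>. With
  \<open>s = |t| powr (p / 2)\<close> the claim reads
  \<open>|1 - t|\<^sup>p \<le> \<eta> (1 + s\<^sup>2) + C ((1 + s\<^sup>2) / 2 - |(1 + t) / 2|\<^sup>p) + D (1 - s)\<^sup>2\<close>.
  If \<open>t\<close> is far from \<open>1\<close>, the parallelogram law keeps \<open>|(1 + t) / 2|\<close> away from \<open>1\<close>, so the
  bracket is large unless \<open>s\<close> is far from \<open>1\<close>, and then the last term is large.
  For \<open>p \<le> 1\<close> and real \<open>t > 0\<close> the bracket is not positive, by concavity, and only the term with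
  \<open>D\<close> penalises \<open>t \<noteq> 1\<close>. All terms are chosen as powers of moduli of holomorphic
  expressions in the two arguments, here \<open>1 - t\<close>, \<open>1 + t\<close> and \<open>t\<close>.
\<close>
lemma unit_disc_powr_convexity:
  fixes p \<eta> :: real
  assumes p: "0 < p" and \<eta>: "0 < \<eta>" "\<eta> \<le> 1"
  shows "\<exists>C\<ge>0. \<exists>D\<ge>0. \<forall>t::complex. norm t \<le> 1 \<longrightarrow>
    norm (1 - t) powr p + C * norm ((1 + t) / 2) powr p + 2 * D * norm t powr (p / 2)
      \<le> (\<eta> + C / 2 + D) * (1 + norm t powr p)"
proof -
  \<comment> \<open>\<open>\<kappa>\<close> is the distance \<open>|1 - t|\<close> below which \<open>\<eta> / 2\<close> suffices; beyond it, \<open>1 - |(1 + t) / 2|\<^sup>p\<close> is at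
    least \<open>\<beta>\<close>.\<close>
  define \<kappa> where "\<kappa> = (\<eta> / 2) powr (1 / p)"
  have \<kappa>: "0 < \<kappa>" "\<kappa> \<le> 1" "\<kappa> powr p = \<eta> / 2"
    using p \<eta> powr_mono2[of "1 / p" "\<eta> / 2" 1] by (auto simp: \<kappa>_def powr_powr)
  define \<beta> where "\<beta> = 1 - (1 - \<kappa>\<^sup>2 / 4) powr (p / 2)"
  have \<kappa>2: "0 < \<kappa>\<^sup>2" "\<kappa>\<^sup>2 \<le> 1" using \<kappa> by (auto simp: power_le_one)
  have "(1 - \<kappa>\<^sup>2 / 4) powr (p / 2) < 1 powr (p / 2)"
    using \<kappa>2 p by (intro powr_less_mono2) auto
  then have \<beta>: "0 < \<beta>" by (simp add: \<beta>_def)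
  define C where "C = 2 powr p / \<beta>"
  define D where "D = C\<^sup>2 / (2 * \<eta>)"
  have C: "0 \<le> C" and D: "0 \<le> D" using \<beta> \<eta> by (auto simp: C_def D_def)
  have "norm (1 - t) powr p + C * norm ((1 + t) / 2) powr p + 2 * D * norm t powr (p / 2)
      \<le> (\<eta> + C / 2 + D) * (1 + norm t powr p)" if t: "norm t \<le> 1" for t :: complex
  proof -
    define s where "s = norm t powr (p / 2)"
    define u where "u = norm ((1 + t) / 2) powr p"
    have s2: "s\<^sup>2 = norm t powr p" by (simp add: s_def power2_eq_square powr_add[symmetric])
    have n1: "norm ((1 + t) / 2) \<le> 1" using norm_triangle_ineq[of 1 t] t by simp
    have u1: "u \<le> 1" unfolding u_def using powr_mono2[of p "norm ((1 + t) / 2)" 1] n1 p by simp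
    have main: "norm (1 - t) powr p \<le> \<eta> / 2 + C * (1 - u)"
    proof (cases "norm (1 - t) \<le> \<kappa>")
      case True
      then have "norm (1 - t) powr p \<le> \<kappa> powr p" using p by (intro powr_mono2) auto
      moreover have "0 \<le> C * (1 - u)" using C u1 by simp
      ultimately show ?thesis using \<kappa>(3) by simp
    next
      case False
      have par: "(norm ((1 + t) / 2))\<^sup>2 = (2 + 2 * (norm t)\<^sup>2 - (norm (1 - t))\<^sup>2) / 4"
      proof -
        have "(norm (1 + t))\<^sup>2 = 2 + 2 * (norm t)\<^sup>2 - (norm (1 - t))\<^sup>2"
          unfolding cmod_power2 by (simp add: power2_eq_square algebra_simps)
        then show ?thesis by (simp add: norm_divide power_divide)
      qed
      have "\<kappa>\<^sup>2 \<le> (norm (1 - t))\<^sup>2" using False \<kappa>(1) by (intro power_mono) auto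
      moreover have "(norm t)\<^sup>2 \<le> 1" using t by (simp add: power_le_one)
      ultimately have "(norm ((1 + t) / 2))\<^sup>2 \<le> 1 - \<kappa>\<^sup>2 / 4" unfolding par by simp
      then have "((norm ((1 + t) / 2))\<^sup>2) powr (p / 2) \<le> (1 - \<kappa>\<^sup>2 / 4) powr (p / 2)"
        using p by (intro powr_mono2) auto
      moreover have "((norm ((1 + t) / 2))\<^sup>2) powr (p / 2) = u"
        using p by (cases "(1 + t) / 2 = 0") (auto simp: u_def powr_powr powr_numeral[symmetric] simp del: powr_numeral)
      ultimately have "\<beta> \<le> 1 - u" by (simp add: \<beta>_def)
      then have "C * \<beta> \<le> C * (1 - u)" using C by (rule mult_left_mono)
      then have "2 powr p \<le> C * (1 - u)" using \<beta> by (simp add: C_def)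
      moreover have "norm (1 - t) powr p \<le> 2 powr p"
        using norm_triangle_ineq4[of 1 t] t p by (intro powr_mono2) auto
      ultimately show ?thesis using \<eta> by linarith
    qed
    \<comment> \<open>Completing squares: \<open>D\<close> is chosen so that the linear term in \<open>1 - s\<close> is absorbed.\<close>
    have sq: "C * (1 - s) \<le> D * (1 - s)\<^sup>2 + \<eta> / 2"
    proof -
      have "0 \<le> (C * (1 - s) - \<eta>)\<^sup>2 / (2 * \<eta>)" using \<eta> by simp
      also have "\<dots> = D * (1 - s)\<^sup>2 - C * (1 - s) + \<eta> / 2"
        using \<eta> by (simp add: D_def field_simps power2_eq_square)
      finally show ?thesis by simp
    qed
    have "0 \<le> C / 2 * (1 - s)\<^sup>2 + \<eta> * s\<^sup>2" using C \<eta> by simp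
    then have "norm (1 - t) powr p + C * u + 2 * D * s \<le> (\<eta> + C / 2 + D) * (1 + s\<^sup>2)"
      using main sq by (simp add: power2_eq_square algebra_simps)
    then show ?thesis unfolding s2 unfolding s_def u_def .
  qed
  then show ?thesis using C D by blast
qed

text \<open>
  Both sides are homogeneous of degree \<open>p\<close> and symmetric, so one may divide by the
  argument of larger modulus.
\<close>
lemma complex_powr_convexity:
  fixes p \<eta> :: real
  assumes p: "0 < p" and \<eta>: "0 < \<eta>" "\<eta> \<le> 1"
  obtains C D where "0 \<le> C" "0 \<le> D"
    "\<And>a b :: complex. norm (a - b) powr p + C * norm ((a + b) / 2) powr p + 2 * D * norm (a * b) powr (p / 2)
      \<le> (\<eta> + C / 2 + D) * (norm a powr p + norm b powr p)"
proof -
  obtain C D where CD: "0 \<le> C" "0 \<le> D" and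
    t: "\<And>t::complex. norm t \<le> 1 \<Longrightarrow>
    norm (1 - t) powr p + C * norm ((1 + t) / 2) powr p + 2 * D * norm t powr (p / 2)
      \<le> (\<eta> + C / 2 + D) * (1 + norm t powr p)"
    using unit_disc_powr_convexity[OF assms] by blast
  have ord: "norm (a - b) powr p + C * norm ((a + b) / 2) powr p + 2 * D * norm (a * b) powr (p / 2)
      \<le> (\<eta> + C / 2 + D) * (norm a powr p + norm b powr p)" if le: "norm b \<le> norm a" for a b :: complex
  proof (cases "a = 0")
    case False
    define t where "t = b / a"
    define r where "r = norm a powr p"
    have b: "b = a * t" using False by (simp add: t_def)
    have "norm t \<le> 1" using le False by (simp add: t_def norm_divide)
    from mult_left_mono[OF t[OF this], of r]
    have "r * norm (1 - t) powr p + C * (r * norm ((1 + t) / 2) powr p) + 2 * D * (r * norm t powr (p / 2))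
        \<le> (\<eta> + C / 2 + D) * (r + r * norm t powr p)"
      by (simp add: r_def algebra_simps)
    moreover have "norm (a - b) powr p = r * norm (1 - t) powr p"
      by (simp add: r_def b powr_mult[symmetric] norm_mult[symmetric] algebra_simps)
    moreover have "norm ((a + b) / 2) powr p = r * norm ((1 + t) / 2) powr p"
      by (simp add: r_def b powr_mult[symmetric] norm_mult[symmetric] algebra_simps)
    moreover have "norm (a * b) powr (p / 2) = r * norm t powr (p / 2)"
      by (simp add: r_def b powr_mult norm_mult mult.assoc[symmetric] powr_add[symmetric])
    moreover have "norm b powr p = r * norm t powr p"
      by (simp add: r_def b powr_mult norm_mult)
    ultimately show ?thesis by (simp add: r_def)
  qed (use le in simp)
  have "norm (a - b) powr p + C * norm ((a + b) / 2) powr p + 2 * D * norm (a * b) powr (p / 2)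
      \<le> (\<eta> + C / 2 + D) * (norm a powr p + norm b powr p)" for a b :: complex
    using ord[of b a] ord[of a b] by (cases "norm b \<le> norm a") (auto simp: norm_minus_commute add.commute mult.commute)
  with CD show ?thesis by (rule that)
qed

lemma norm_add_powr_le:
  fixes a b :: complex
  assumes "0 < p"
  shows "norm (a + b) powr p \<le> 2 powr p * (norm a powr p + norm b powr p)"
proof -
  have "norm (a + b) \<le> 2 * max (norm a) (norm b)"
    using norm_triangle_ineq[of a b] by simp
  then have "norm (a + b) powr p \<le> (2 * max (norm a) (norm b)) powr p"
    using assms by (intro powr_mono2) auto
  also have "\<dots> = 2 powr p * max (norm a) (norm b) powr p"
    by (simp add: powr_mult)
  also have "max (norm a) (norm b) powr p \<le> norm a powr p + norm b powr p"
    by (simp add: max_def)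
  finally show ?thesis by simp
qed

lemma norm_mult_powr_half_le:
  fixes a b :: complex
  shows "norm (a * b) powr (p / 2) \<le> norm a powr p + norm b powr p"
proof -
  have *: "(x powr (p / 2))\<^sup>2 = x powr p" for x :: real
    by (simp add: power2_eq_square powr_add[symmetric])
  have "0 \<le> norm a powr p + norm b powr p" by simp
  moreover have "2 * (norm a powr (p/2) * norm b powr (p/2)) \<le> norm a powr p + norm b powr p"
    using sum_squares_bound[of "norm a powr (p/2)" "norm b powr (p/2)"] by (simp add: * mult.assoc)
  ultimately have "norm a powr (p/2) * norm b powr (p/2) \<le> norm a powr p + norm b powr p" by linarith
  then show ?thesis by (simp add: norm_mult powr_mult)
qed

text \<open>
  All sums, products and differences below are bounded on lines through such a pointwise bound.
\<close>
lemma line_mass_le_add: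
  assumes f: "f holomorphic_on {z. Im z < c}" and g: "g holomorphic_on {z. Im z < c}"
    and p: "0 < p" and y: "y < c" and A: "0 \<le> A"
    and le: "\<And>z. Im z < c \<Longrightarrow> norm (F z) powr q \<le> A * (norm (f z) powr p + norm (g z) powr p)"
  shows "line_mass q F y \<le> ennreal A * (line_mass p f y + line_mass p g y)"
proof -
  note [measurable] = measurable_line[OF f p y] measurable_line[OF g p y]
  have "line_mass q F y \<le>
      (\<integral>\<^sup>+x. ennreal A * (ennreal (norm (f (Complex x y)) powr p) + ennreal (norm (g (Complex x y)) powr p)) \<partial>lborel)"
    unfolding line_mass_def
    by (intro nn_integral_mono) (use le[of "Complex _ y"] y A in
        \<open>auto simp: ennreal_mult'[symmetric] ennreal_plus[symmetric] ennreal_leI simp del: ennreal_plus\<close>)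
  also have "\<dots> = ennreal A * (line_mass p f y + line_mass p g y)"
    unfolding line_mass_def by (simp add: nn_integral_cmult nn_integral_add)
  finally show ?thesis .
qed

lemma line_mass_shift: "line_mass q (\<lambda>z. F (z - \<i> * of_real d)) y = line_mass q F (y - d)"
proof -
  have "Complex x y - \<i> * of_real d = Complex x (y - d)" for x by (simp add: complex_eq_iff)
  then show ?thesis by (simp add: line_mass_def)
qed

text \<open>
  Fatou's lemma. The alternative \<open>c \<le> 0\<close> in the last hypothesis covers negative \<open>c\<close>, which become
  \<open>0\<close> as extended reals, where the strict inequality can fail.
\<close>
lemma eventually_line_mass_ge:
  assumes meas: "\<And>n. (\<lambda>x. norm (h n (Complex x y)) powr q) \<in> borel_measurable borel"
    and lim: "\<And>x. (\<lambda>n. norm (h n (Complex x y)) powr q) \<longlonglongrightarrow> u x"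
    and c: "ennreal c < (\<integral>\<^sup>+x. ennreal (u x) \<partial>lborel) \<or> c \<le> 0"
  shows "\<forall>\<^sub>F n in sequentially. ennreal c \<le> line_mass q (h n) y"
proof (cases "c \<le> 0")
  case False
  note [measurable] = meas
  have "ennreal c < (\<integral>\<^sup>+x. ennreal (u x) \<partial>lborel)" using c False by simp
  also have "\<dots> = (\<integral>\<^sup>+x. liminf (\<lambda>n. ennreal (norm (h n (Complex x y)) powr q)) \<partial>lborel)"
    by (intro nn_integral_cong lim_imp_Liminf[symmetric] tendsto_ennrealI lim) simp
  also have "\<dots> \<le> liminf (\<lambda>n. line_mass q (h n) y)"
    unfolding line_mass_def by (intro nn_integral_liminf) simp
  finally have "\<forall>\<^sub>F n in sequentially. ennreal c < line_mass q (h n) y"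
    by (rule less_LiminfD)
  then show ?thesis by (rule eventually_mono) simp
qed (simp add: ennreal_neg)

lemma nn_integral_lincomb:
  fixes u v w :: "'a \<Rightarrow> ennreal"
  assumes [measurable]: "u \<in> borel_measurable M" "v \<in> borel_measurable M" "w \<in> borel_measurable M"
  shows "(\<integral>\<^sup>+x. u x + c * v x + d * w x \<partial>M)
    = (\<integral>\<^sup>+x. u x \<partial>M) + c * (\<integral>\<^sup>+x. v x \<partial>M) + d * (\<integral>\<^sup>+x. w x \<partial>M)"
  by (simp add: nn_integral_add nn_integral_cmult)

text \<open>
  Let \<open>m\<close> be the supremum of the integrals of \<open>|f|\<^sup>p\<close> over lines and \<open>g\<close> a small translate
  of \<open>f\<close>. Its integrals are also at most \<open>m\<close>. On a line at height \<open>y0\<close> that nearly attains \<open>m\<close>,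
  Fatou's lemma makes the integrals of \<open>|(f + g) / 2|\<^sup>p\<close> and of
  \<open>|f g| powr (p / 2)\<close> nearly \<open>m\<close> as well. By monotonicity this persists on all lines above
  \<open>y0\<close>, so the convexity inequality forces the integral of \<open>|f - g|\<^sup>p\<close> to be small there;
  by monotonicity again it is small below \<open>y0\<close>.
\<close>
lemma translation_approx:
  assumes hol: "f holomorphic_on {z. Im z < 0}" and p: "0 < p"
    and K: "\<And>y. y < 0 \<Longrightarrow> line_mass p f y \<le> ennreal K" and \<eta>: "0 < \<eta>"
  shows "\<exists>\<delta>>0. \<forall>y<0. line_mass p (\<lambda>z. f z - f (z - \<i> * of_real \<delta>)) y \<le> ennreal \<eta>"
proof -
  define L where "L y = enn2real (line_mass p f y)" for y
  have fin: "line_mass p f y < top" if "y < 0" for y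
    using K[OF that] by (simp add: order_le_less_trans)
  have LM: "line_mass p f y = ennreal (L y)" if "y < 0" for y
    using fin[OF that] by (simp add: L_def)
  have L0: "0 \<le> L y" for y by (simp add: L_def)
  have "L y \<le> max K 0" if "y < 0" for y
  proof -
    have "ennreal (L y) \<le> ennreal (max K 0)"
      using K[OF that] unfolding LM[OF that] by (rule order_trans) (simp add: ennreal_leI)
    then show ?thesis by (simp add: ennreal_le_iff)
  qed
  then have bdd: "bdd_above (L ` {..<0})" by (auto simp: bdd_above_def)
  define m where "m = (SUP y\<in>{..<0}. L y)"
  have Lm: "L y \<le> m" if "y < 0" for y unfolding m_def by (rule cSUP_upper) (use that bdd in auto)
  have m0: "0 \<le> m" using Lm[of "-1"] L0[of "-1"] by simp
  define \<eta>1 where "\<eta>1 = min 1 (\<eta> / (4 * (m + 1)))"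
  have \<eta>1: "0 < \<eta>1" "\<eta>1 \<le> 1" using \<eta> m0 by (auto simp: \<eta>1_def)
  have \<eta>1m: "2 * \<eta>1 * m \<le> \<eta> / 2"
  proof -
    have "2 * \<eta>1 * m \<le> 2 * (\<eta> / (4 * (m + 1))) * m"
      using m0 by (intro mult_right_mono) (auto simp: \<eta>1_def)
    also have "\<dots> \<le> \<eta> / 2" using m0 \<eta> by (simp add: field_simps)
    finally show ?thesis .
  qed
  obtain C D where CD: "0 \<le> C" "0 \<le> D" and conv:
    "\<And>a b :: complex. norm (a - b) powr p + C * norm ((a + b) / 2) powr p + 2 * D * norm (a * b) powr (p / 2)
      \<le> (\<eta>1 + C / 2 + D) * (norm a powr p + norm b powr p)"
    by (rule complex_powr_convexity[OF p \<eta>1]) blast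
  define \<epsilon> where "\<epsilon> = \<eta> / (2 * (C + 2 * D + 1))"
  have \<epsilon>: "0 < \<epsilon>" using CD \<eta> by (simp add: \<epsilon>_def)
  have \<epsilon>C: "(C + 2 * D) * \<epsilon> \<le> \<eta> / 2" using CD \<eta> by (simp add: \<epsilon>_def field_simps)
  obtain y0 where y0: "y0 < 0" "m - \<epsilon> < L y0"
    using less_cSUP_iff[of "{..<0}" L "m - \<epsilon>"] bdd \<epsilon> unfolding m_def by force
  define g where "g n z = f (z - \<i> * of_real (1 / real (n + 1)))" for n :: nat and z
  have neg: "y - 1 / real (n + 1) < 0" if "y < 0" for y n
    using that by (smt (verit) divide_nonneg_nonneg of_nat_0_le_iff)
  have ghol: "g n holomorphic_on {z. Im z < 0}" for n
  proof -
    have "(f \<circ> (\<lambda>z. z - \<i> * of_real (1 / real (n + 1)))) holomorphic_on {z. Im z < 0}"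
      by (intro holomorphic_on_compose_gen[OF _ hol] holomorphic_intros)
         (use neg[of "Im _" n] in \<open>auto simp del: of_nat_add\<close>)
    then show ?thesis by (simp add: g_def[abs_def] o_def)
  qed
  have gL: "line_mass p (g n) y = ennreal (L (y - 1 / real (n + 1)))" if "y < 0" for n y
    unfolding g_def[abs_def] line_mass_shift
    by (rule LM) (rule neg[OF that])
  have glim: "(\<lambda>n. g n (Complex x y0)) \<longlonglongrightarrow> f (Complex x y0)" for x
    unfolding g_def
  proof (rule continuous_on_tendsto_compose[OF holomorphic_on_imp_continuous_on[OF hol]])
    have "(\<lambda>n. 1 / real (n + 1)) \<longlonglongrightarrow> 0" by real_asymp
    then have "(\<lambda>n. Complex x y0 - \<i> * of_real (1 / real (n + 1))) \<longlonglongrightarrow> Complex x y0 - \<i> * of_real 0"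
      by (intro tendsto_intros)
    then show "(\<lambda>n. Complex x y0 - \<i> * of_real (1 / real (n + 1))) \<longlonglongrightarrow> Complex x y0" by simp
    show "\<forall>\<^sub>F n in sequentially. Complex x y0 - \<i> * of_real (1 / real (n + 1)) \<in> {z. Im z < 0}"
      using neg[OF y0(1)] by (auto intro!: always_eventually simp del: of_nat_add)
  qed (use y0 in auto)
  have ahol: "(\<lambda>z. (f z + g n z) / 2) holomorphic_on {z. Im z < 0}"
    and phol: "(\<lambda>z. f z * g n z) holomorphic_on {z. Im z < 0}"
    and dhol: "(\<lambda>z. f z - g n z) holomorphic_on {z. Im z < 0}" for n
    by (intro holomorphic_intros hol ghol; simp)+
  have Ly0: "ennreal (m - \<epsilon>) < (\<integral>\<^sup>+x. ennreal (norm (f (Complex x y0)) powr p) \<partial>lborel) \<or> m - \<epsilon> \<le> 0"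
    using y0 LM[OF y0(1)] unfolding line_mass_def by (auto simp: ennreal_lessI)
  have ev1: "\<forall>\<^sub>F n in sequentially. ennreal (m - \<epsilon>) \<le> line_mass p (\<lambda>z. (f z + g n z) / 2) y0"
  proof (rule eventually_line_mass_ge[OF _ _ Ly0])
    show "(\<lambda>x. norm ((f (Complex x y0) + g n (Complex x y0)) / 2) powr p) \<in> borel_measurable borel" for n
      by (rule measurable_line[OF ahol p y0(1)])
    show "(\<lambda>n. norm ((f (Complex x y0) + g n (Complex x y0)) / 2) powr p) \<longlonglongrightarrow> norm (f (Complex x y0)) powr p" for x
    proof (rule tendsto_powr')
      have "(\<lambda>n. norm ((f (Complex x y0) + g n (Complex x y0)) / 2)) \<longlonglongrightarrow> norm ((f (Complex x y0) + f (Complex x y0)) / 2)"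
        by (intro tendsto_intros glim) simp
      then show "(\<lambda>n. norm ((f (Complex x y0) + g n (Complex x y0)) / 2)) \<longlonglongrightarrow> norm (f (Complex x y0))" by simp
    qed (use p in auto)
  qed
  have ev2: "\<forall>\<^sub>F n in sequentially. ennreal (m - \<epsilon>) \<le> line_mass (p / 2) (\<lambda>z. f z * g n z) y0"
  proof (rule eventually_line_mass_ge[OF _ _ Ly0])
    show "(\<lambda>x. norm (f (Complex x y0) * g n (Complex x y0)) powr (p / 2)) \<in> borel_measurable borel" for n
      by (rule measurable_line[OF phol _ y0(1)]) (use p in simp)
    show "(\<lambda>n. norm (f (Complex x y0) * g n (Complex x y0)) powr (p / 2)) \<longlonglongrightarrow> norm (f (Complex x y0)) powr p" for x
    proof -
      have "(\<lambda>n. norm (f (Complex x y0) * g n (Complex x y0)) powr (p / 2))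
          \<longlonglongrightarrow> norm (f (Complex x y0) * f (Complex x y0)) powr (p / 2)"
        by (intro tendsto_powr' tendsto_intros glim) (use p in auto)
      then show ?thesis by (simp add: norm_mult powr_mult powr_add[symmetric])
    qed
  qed
  obtain n where n1: "ennreal (m - \<epsilon>) \<le> line_mass p (\<lambda>z. (f z + g n z) / 2) y0"
    and n2: "ennreal (m - \<epsilon>) \<le> line_mass (p / 2) (\<lambda>z. f z * g n z) y0"
    using eventually_happens[OF eventually_conj[OF ev1 ev2]] by auto
  have gm: "line_mass p (g n) y \<le> ennreal m" if "y < 0" for y
    unfolding gL[OF that] by (intro ennreal_leI Lm neg that)
  have fm: "line_mass p f y \<le> ennreal m" if "y < 0" for y
    unfolding LM[OF that] by (intro ennreal_leI Lm that)
  have bound: "line_mass q F y \<le> ennreal (A * (2 * m))"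
    if "0 \<le> A" "\<And>z. norm (F z) powr q \<le> A * (norm (f z) powr p + norm (g n z) powr p)" "y < 0" for q F A y
  proof -
    have "line_mass q F y \<le> ennreal A * (line_mass p f y + line_mass p (g n) y)"
      by (rule line_mass_le_add[OF hol ghol p that(3,1,2)])
    also have "\<dots> \<le> ennreal A * (ennreal m + ennreal m)"
      by (intro mult_left_mono add_mono fm gm that) simp
    also have "\<dots> = ennreal (A * (2 * m))"
      using that m0 by (simp add: ennreal_mult'[symmetric] ennreal_plus[symmetric] del: ennreal_plus)
    finally show ?thesis .
  qed
  have bd: "norm (f z - g n z) powr p \<le> 2 powr p * (norm (f z) powr p + norm (g n z) powr p)" for z
    using norm_add_powr_le[OF p, of "f z" "- g n z"] by simp
  have bp: "norm (f z * g n z) powr (p / 2) \<le> 1 * (norm (f z) powr p + norm (g n z) powr p)" for z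
    using norm_mult_powr_half_le[of "f z" "g n z" p] by simp
  have ba: "norm ((f z + g n z) / 2) powr p \<le> 2 powr p * (norm (f z) powr p + norm (g n z) powr p)" for z
  proof -
    have "norm ((f z + g n z) / 2) powr p \<le> norm (f z + g n z) powr p"
      using p by (intro powr_mono2) (auto simp: norm_divide)
    then show ?thesis using norm_add_powr_le[OF p, of "f z" "g n z"] by linarith
  qed
  have near: "line_mass p (\<lambda>z. f z - g n z) y \<le> ennreal \<eta>" if y: "y0 \<le> y" "y < 0" for y
  proof -
    define d where "d = enn2real (line_mass p (\<lambda>z. f z - g n z) y)"
    define a where "a = enn2real (line_mass p (\<lambda>z. (f z + g n z) / 2) y)"
    define b where "b = enn2real (line_mass (p / 2) (\<lambda>z. f z * g n z) y)"
    have d: "line_mass p (\<lambda>z. f z - g n z) y = ennreal d"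
      using le_less_trans[OF bound[OF _ bd y(2)]] by (simp add: d_def)
    have a: "line_mass p (\<lambda>z. (f z + g n z) / 2) y = ennreal a"
      using le_less_trans[OF bound[OF _ ba y(2)]] by (simp add: a_def)
    have b: "line_mass (p / 2) (\<lambda>z. f z * g n z) y = ennreal b"
      using le_less_trans[OF bound[OF _ bp y(2)]] by (simp add: b_def)
    have pos: "0 \<le> d" "0 \<le> a" "0 \<le> b" by (simp_all add: d_def a_def b_def)
    have "ennreal (m - \<epsilon>) \<le> ennreal a"
      using n1 line_mass_mono[OF ahol p bound[OF _ ba] y] unfolding a by (auto intro: order_trans)
    then have ma: "m - \<epsilon> \<le> a" using pos by (auto simp: ennreal_le_iff2)
    have "ennreal (m - \<epsilon>) \<le> ennreal b"
      using n2 line_mass_mono[OF phol _ bound[OF _ bp] y] p unfolding b by (auto intro: order_trans)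
    then have mb: "m - \<epsilon> \<le> b" using pos by (auto simp: ennreal_le_iff2)
    have meas[measurable]: "(\<lambda>x. norm (f (Complex x y) - g n (Complex x y)) powr p) \<in> borel_measurable borel"
      "(\<lambda>x. norm ((f (Complex x y) + g n (Complex x y)) / 2) powr p) \<in> borel_measurable borel"
      "(\<lambda>x. norm (f (Complex x y) * g n (Complex x y)) powr (p / 2)) \<in> borel_measurable borel"
      "(\<lambda>x. norm (f (Complex x y)) powr p) \<in> borel_measurable borel"
      "(\<lambda>x. norm (g n (Complex x y)) powr p) \<in> borel_measurable borel"
      using measurable_line[OF dhol p y(2)] measurable_line[OF ahol p y(2)] measurable_line[OF phol _ y(2), of "p / 2"]
        measurable_line[OF hol p y(2)] measurable_line[OF ghol p y(2)] p by simp_all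
    have "ennreal d + ennreal C * ennreal a + ennreal (2 * D) * ennreal b
        = (\<integral>\<^sup>+x. ennreal (norm (f (Complex x y) - g n (Complex x y)) powr p)
            + ennreal C * ennreal (norm ((f (Complex x y) + g n (Complex x y)) / 2) powr p)
            + ennreal (2 * D) * ennreal (norm (f (Complex x y) * g n (Complex x y)) powr (p / 2)) \<partial>lborel)"
      unfolding d[symmetric] a[symmetric] b[symmetric] line_mass_def
      by (rule nn_integral_lincomb[symmetric])
         (use meas(1-3)[THEN measurable_compose, OF measurable_ennreal] in simp_all)
    also have "\<dots> \<le> (\<integral>\<^sup>+x. ennreal (\<eta>1 + C / 2 + D) *
        (ennreal (norm (f (Complex x y)) powr p) + ennreal (norm (g n (Complex x y)) powr p)) \<partial>lborel)"
      by (intro nn_integral_mono)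
         (use conv CD \<eta>1 in \<open>simp add: ennreal_mult'[symmetric] ennreal_plus[symmetric] ennreal_leI del: ennreal_plus\<close>)
    also have "\<dots> = ennreal (\<eta>1 + C / 2 + D) * (line_mass p f y + line_mass p (g n) y)"
      unfolding line_mass_def by (simp add: nn_integral_cmult nn_integral_add)
    also have "\<dots> \<le> ennreal (\<eta>1 + C / 2 + D) * (ennreal m + ennreal m)"
      by (intro mult_left_mono add_mono fm gm y) simp
    finally have "d + C * a + 2 * D * b \<le> (\<eta>1 + C / 2 + D) * (m + m)"
      using CD \<eta>1 m0 pos
      by (simp add: ennreal_mult'[symmetric] ennreal_plus[symmetric] ennreal_le_iff del: ennreal_plus)
    moreover have "C * (m - \<epsilon>) \<le> C * a" "2 * D * (m - \<epsilon>) \<le> 2 * D * b"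
      using ma mb CD by (auto intro!: mult_left_mono)
    ultimately have "d \<le> 2 * \<eta>1 * m + (C + 2 * D) * \<epsilon>" by (simp add: algebra_simps)
    then have "d \<le> \<eta>" using \<eta>1m \<epsilon>C by simp
    then show ?thesis unfolding d by (rule ennreal_leI)
  qed
  have "line_mass p (\<lambda>z. f z - g n z) y \<le> ennreal \<eta>" if y: "y < 0" for y
  proof (cases "y0 \<le> y")
    case False
    then have "line_mass p (\<lambda>z. f z - g n z) y \<le> line_mass p (\<lambda>z. f z - g n z) y0"
      by (intro line_mass_mono[OF dhol p bound[OF _ bd]]) (use y0 in auto)
    then show ?thesis using near[of y0] y0 by (auto intro: order_trans)
  qed (use near y in auto)
  then show ?thesis
    by (intro exI[of _ "1 / real (n + 1)"]) (simp add: g_def)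
qed

section \<open>Rational approximation\<close>

text \<open>
  The damping factor has modulus at most \<open>1\<close> on the lower half plane. Since \<open>h\<close>
  lives on a larger half plane, monotonicity reduces the claim to dominated convergence on the
  real line. The bound \<open>2 ^ k\<close> on the damping factor in a slightly larger half plane serves
  only to make the integrals there finite, so that monotonicity applies up to the real line.
\<close>
lemma damping_approx:
  assumes hol: "h holomorphic_on {z. Im z < c}" and c: "0 < c" and p: "0 < p"
    and K: "\<And>y. y < c \<Longrightarrow> line_mass p h y \<le> ennreal K" and \<eta>: "0 < \<eta>"
  shows "\<exists>\<epsilon>>0. \<forall>y<0. line_mass p (\<lambda>z. h z - h z / (1 + \<i> * of_real \<epsilon> * z) ^ k) y \<le> ennreal \<eta>"
proof -
  define e where "e n = 1 / real (n + 1)" for n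
  have e: "0 < e n" "e n \<le> 1" for n by (auto simp: e_def)
  define F where "F n z = h z - h z / (1 + \<i> * of_real (e n) * z) ^ k" for n z
  define c1 where "c1 = min c (1/2)"
  have c1: "0 < c1" "c1 \<le> c" "c1 \<le> 1/2" using c by (auto simp: c1_def)
  have hol1: "h holomorphic_on {z. Im z < c1}" by (rule holomorphic_on_subset[OF hol]) (use c1 in auto)
  have lower: "1 / 2 \<le> norm (1 + \<i> * of_real (e n) * z)" if "Im z < c1" for n z
  proof -
    have "e n * Im z \<le> 1 / 2"
    proof (cases "0 \<le> Im z")
      case True
      then have "e n * Im z \<le> 1 * (1/2)" using that c1 e[of n] by (intro mult_mono) auto
      then show ?thesis by simp
    next
      case False
      then have "e n * Im z \<le> 0" using e[of n] by (simp add: mult_nonneg_nonpos)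
      then show ?thesis by linarith
    qed
    then have "1 / 2 \<le> Re (1 + \<i> * of_real (e n) * z)" by simp
    also have "\<dots> \<le> norm (1 + \<i> * of_real (e n) * z)" by (rule complex_Re_le_cmod)
    finally show ?thesis .
  qed
  have Fhol: "F n holomorphic_on {z. Im z < c1}" for n
    unfolding F_def using lower[of _ n] by (intro holomorphic_intros hol1) force
  define A where "A = (1 + 2 ^ k) powr p"
  have A: "0 \<le> A" by (simp add: A_def)
  have Fle: "norm (F n z) powr p \<le> A * norm (h z) powr p" if "Im z < c1" for n z
  proof -
    have "(1 / 2) ^ k \<le> norm (1 + \<i> * of_real (e n) * z) ^ k"
      using lower[OF that] by (intro power_mono) auto
    then have "norm (h z) / norm (1 + \<i> * of_real (e n) * z) ^ k \<le> norm (h z) / (1 / 2) ^ k"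
      by (intro divide_left_mono) (use lower[OF that, of n] in \<open>auto intro!: mult_pos_pos zero_less_power\<close>)
    then have "norm (h z / (1 + \<i> * of_real (e n) * z) ^ k) \<le> 2 ^ k * norm (h z)"
      by (simp add: norm_divide norm_power power_one_over mult.commute)
    then have "norm (F n z) \<le> (1 + 2 ^ k) * norm (h z)"
      unfolding F_def using norm_triangle_ineq4[of "h z" "h z / (1 + \<i> * of_real (e n) * z) ^ k"]
      by (simp add: algebra_simps)
    then have "norm (F n z) powr p \<le> ((1 + 2 ^ k) * norm (h z)) powr p"
      using p by (intro powr_mono2) auto
    then show ?thesis by (simp add: A_def powr_mult)
  qed
  have Fbound: "line_mass p (F n) y \<le> ennreal (A * (2 * max K 0))" if "y < c1" for n y
  proof -
    have "line_mass p (F n) y \<le> ennreal A * (line_mass p h y + line_mass p h y)"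
    proof (rule line_mass_le_add[OF hol1 hol1 p that A])
      fix z assume "Im z < c1"
      moreover have "0 \<le> A * norm (h z) powr p" using A by simp
      ultimately show "norm (F n z) powr p \<le> A * (norm (h z) powr p + norm (h z) powr p)"
        using Fle[of z n] unfolding distrib_left by linarith
    qed
    also have "line_mass p h y \<le> ennreal (max K 0)"
      using K[of y] that c1 by (auto intro: order_trans ennreal_leI)
    then have "ennreal A * (line_mass p h y + line_mass p h y) \<le> ennreal A * (ennreal (max K 0) + ennreal (max K 0))"
      by (intro mult_left_mono add_mono) auto
    also have "\<dots> = ennreal (A * (2 * max K 0))"
      using A by (simp add: ennreal_mult'[symmetric] ennreal_plus[symmetric] del: ennreal_plus)
    finally show ?thesis .
  qed
  note hm = measurable_line[OF hol1 p c1(1)]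
  have "(\<lambda>n. line_mass p (F n) 0) \<longlonglongrightarrow> (\<integral>\<^sup>+x. 0 \<partial>(lborel :: real measure))"
    unfolding line_mass_def
  proof (rule nn_integral_dominated_convergence)
    show "(\<lambda>x. ennreal (norm (F n (Complex x 0)) powr p)) \<in> borel_measurable lborel" for n
      using measurable_compose[OF measurable_line[OF Fhol p c1(1)] measurable_ennreal] by simp
    show "(\<lambda>x. ennreal A * ennreal (norm (h (Complex x 0)) powr p)) \<in> borel_measurable lborel"
      using hm by simp
    show "AE x in lborel. ennreal (norm (F n (Complex x 0)) powr p) \<le> ennreal A * ennreal (norm (h (Complex x 0)) powr p)" for n
      using Fle[of "Complex _ 0" n] c1 A by (intro AE_I2) (simp add: ennreal_mult'[symmetric] ennreal_leI)
    have "(\<integral>\<^sup>+x. ennreal A * ennreal (norm (h (Complex x 0)) powr p) \<partial>lborel) = ennreal A * line_mass p h 0"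
      unfolding line_mass_def using hm by (intro nn_integral_cmult) simp
    also have "\<dots> < \<infinity>"
      using K[OF c] by (simp add: ennreal_mult_less_top order_le_less_trans)
    finally show "(\<integral>\<^sup>+x. ennreal A * ennreal (norm (h (Complex x 0)) powr p) \<partial>lborel) < \<infinity>" .
    show "AE x in lborel. (\<lambda>n. ennreal (norm (F n (Complex x 0)) powr p)) \<longlonglongrightarrow> 0"
    proof (rule AE_I2)
      fix x
      have "e \<longlonglongrightarrow> 0" unfolding e_def by real_asymp
      then have "(\<lambda>n. F n (Complex x 0)) \<longlonglongrightarrow> h (Complex x 0) - h (Complex x 0) / (1 + \<i> * of_real 0 * Complex x 0) ^ k"
        unfolding F_def by (intro tendsto_intros) auto
      then have "(\<lambda>n. norm (F n (Complex x 0))) \<longlonglongrightarrow> 0" by (intro tendsto_norm_zero) simp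
      then have "(\<lambda>n. norm (F n (Complex x 0)) powr p) \<longlonglongrightarrow> 0 powr p"
        by (intro tendsto_powr') (use p in auto)
      then have "(\<lambda>n. ennreal (norm (F n (Complex x 0)) powr p)) \<longlonglongrightarrow> ennreal (0 powr p)"
        by (rule tendsto_ennrealI)
      then show "(\<lambda>n. ennreal (norm (F n (Complex x 0)) powr p)) \<longlonglongrightarrow> 0" by simp
    qed
  qed simp_all
  then have "\<forall>\<^sub>F n in sequentially. line_mass p (F n) 0 < ennreal \<eta>"
    by (rule order_tendstoD(2)) (use \<eta> in simp)
  then obtain n where n: "line_mass p (F n) 0 < ennreal \<eta>" by (auto simp: eventually_sequentially)
  have "line_mass p (F n) y \<le> ennreal \<eta>" if "y < 0" for y
    using line_mass_mono[OF Fhol p Fbound, of y 0 n] that c1(1) n by simp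
  then show ?thesis
    by (intro exI[of _ "e n"]) (simp add: e F_def[abs_def])
qed

text \<open>
  A small dilation makes \<open>G\<close> holomorphic beyond the closed disc, where its Taylor polynomials
  converge uniformly.
\<close>
lemma disc_algebra_polynomial_approx:
  fixes G :: "complex \<Rightarrow> complex"
  assumes cont: "continuous_on (cball 0 1) G" and hol: "G holomorphic_on ball 0 1" and \<eta>: "0 < \<eta>"
  shows "\<exists>Q. \<forall>w\<in>cball 0 1. norm (G w - poly Q w) \<le> \<eta>"
proof -
  have "uniformly_continuous_on (cball 0 1) G"
    by (rule compact_uniformly_continuous[OF cont compact_cball])
  then obtain d where d: "0 < d"
    "\<And>w w'. w \<in> cball 0 1 \<Longrightarrow> w' \<in> cball 0 1 \<Longrightarrow> dist w' w < d \<Longrightarrow> dist (G w') (G w) < \<eta> / 2"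
    unfolding uniformly_continuous_on_def using \<eta> by (metis half_gt_zero)
  define r where "r = 1 - min (d / 2) (1 / 2)"
  have r: "0 < r" "r < 1" "1 - r < d" using d(1) by (auto simp: r_def min_def)
  define a where "a n = (deriv ^^ n) G 0 / fact n" for n
  have sums: "(\<lambda>n. a n * w ^ n) sums G w" if "w \<in> ball 0 1" for w
    using holomorphic_power_series[OF hol that] by (simp add: a_def)
  define s where "s = (r + 1) / 2"
  have s: "r < s" "s < 1" "0 < s" using r by (auto simp: s_def)
  have "ereal s = ereal (norm (of_real s :: complex))" using s by simp
  also have "\<dots> \<le> conv_radius a"
    by (rule conv_radius_geI) (use sums[of "of_real s"] s in \<open>auto simp: sums_iff\<close>)
  finally have "ereal r < conv_radius a" using s(1) by (meson ereal_less_eq(3) less_ereal.simps(1) order_less_le_trans)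
  then have "uniform_limit (cball 0 r) (\<lambda>n x. \<Sum>i<n. a i * (x - 0) ^ i) (\<lambda>x. suminf (\<lambda>i. a i * (x - 0) ^ i)) sequentially"
    by (rule powser_uniform_limit)
  then obtain n where n: "\<And>x. x \<in> cball 0 r \<Longrightarrow> dist (\<Sum>i<n. a i * x ^ i) (\<Sum>i. a i * x ^ i) < \<eta> / 2"
    unfolding uniform_limit_iff eventually_sequentially using \<eta> by (metis diff_zero half_gt_zero order_refl)
  define Q where "Q = (\<Sum>i<n. monom (a i * of_real r ^ i) i)"
  have "norm (G w - poly Q w) \<le> \<eta>" if w: "w \<in> cball 0 1" for w
  proof -
    have rw: "norm (of_real r * w) \<le> r" using w r by (simp add: norm_mult mult_left_le)
    have "norm (of_real r * w - w) = (1 - r) * norm w"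
    proof -
      have "of_real r * w - w = of_real (r - 1) * w" by (simp add: algebra_simps)
      moreover have "\<bar>r - 1\<bar> = 1 - r" using r by simp
      ultimately show ?thesis by (simp only: norm_mult norm_of_real)
    qed
    also have "\<dots> \<le> (1 - r) * 1" using w r by (intro mult_left_mono) auto
    finally have "norm (of_real r * w - w) < d" using r by simp
    then have 1: "dist (G (of_real r * w)) (G w) < \<eta> / 2"
      using rw r w by (intro d(2)) (auto simp: dist_norm)
    have "suminf (\<lambda>i. a i * (of_real r * w) ^ i) = G (of_real r * w)"
      using sums[of "of_real r * w"] rw r by (simp add: sums_iff)
    moreover have "poly Q w = (\<Sum>i<n. a i * (of_real r * w) ^ i)"
      by (simp add: Q_def poly_sum poly_monom power_mult_distrib mult.assoc)
    ultimately have "dist (poly Q w) (G (of_real r * w)) < \<eta> / 2"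
      using n[of "of_real r * w"] rw by simp
    with 1 have "dist (poly Q w) (G w) < \<eta>"
      using dist_triangle[of "poly Q w" "G w" "G (of_real r * w)"] by linarith
    then show ?thesis by (simp add: dist_norm norm_minus_commute)
  qed
  then show ?thesis by blast
qed

text \<open>
  The map \<open>z \<mapsto> w = 1 + 2 i / (z - i)\<close> takes the lower half plane to the unit disc and \<open>\<infinity>\<close> to \<open>1\<close>;
  \<open>\<psi>\<close> below is its inverse. Polynomials in \<open>w\<close> are polynomials in \<open>1 / (z - i)\<close>, so after removing the
  factor \<open>(z - i) ^ -(N + 1)\<close> from \<open>g\<close>, one has to approximate a function of \<open>w\<close> uniformly by
  polynomials. The decay of order \<open>N + 2\<close>, one more than the factor removed, makes that function
  vanish continuously at \<open>w = 1\<close>.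
\<close>
lemma rational_class_approx:
  fixes g :: "complex \<Rightarrow> complex"
  assumes cont: "continuous_on {z. Im z \<le> 0} g" and hol: "g holomorphic_on {z. Im z < 0}"
    and decay: "\<And>z. Im z \<le> 0 \<Longrightarrow> norm (g z) * norm (z - \<i>) ^ (N + 2) \<le> B" and \<eta>: "0 < \<eta>"
  shows "\<exists>r\<in>rational_class N. \<forall>z. Im z < 0 \<longrightarrow>
    norm (g z - r z) \<le> \<eta> * norm (inverse (z - \<i>) ^ (N + 1))"
proof -
  define \<psi> where "\<psi> w = \<i> + 2 * \<i> / (w - 1)" for w :: complex
  have Im\<psi>: "Im (\<psi> w) = ((norm w)\<^sup>2 - 1) / (norm (w - 1))\<^sup>2" if "w \<noteq> 1" for w
  proof -
    have nz: "(Re w - 1)\<^sup>2 + (Im w)\<^sup>2 \<noteq> 0"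
      using that by (simp add: sum_power2_eq_zero_iff complex_eq_iff)
    have "Im (\<psi> w) = 1 + 2 * (Re w - 1) / ((Re w - 1)\<^sup>2 + (Im w)\<^sup>2)"
      by (simp add: \<psi>_def Im_divide)
    also have "\<dots> = ((norm w)\<^sup>2 - 1) / (norm (w - 1))\<^sup>2"
      using nz by (simp add: cmod_power2 field_simps) (simp add: power2_eq_square algebra_simps)
    finally show ?thesis .
  qed
  define G where "G w = (if w = 1 then 0 else g (\<psi> w) * (\<psi> w - \<i>) ^ (N + 1))" for w
  have le: "Im (\<psi> w) \<le> 0" if "w \<noteq> 1" "norm w \<le> 1" for w
    using that Im\<psi>[of w] by (simp add: divide_nonpos_nonneg power_le_one)
  have lt: "Im (\<psi> w) < 0" if "norm w < 1" for w
  proof -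
    have w1: "w \<noteq> 1" using that by auto
    have "(norm w)\<^sup>2 < 1" using that by (simp add: abs_square_less_1)
    then show ?thesis unfolding Im\<psi>[OF w1] using w1 by (intro divide_neg_pos) auto
  qed
  have Gbound: "norm (G w) \<le> B / 2 * norm (w - 1)" if w: "norm w \<le> 1" for w
  proof (cases "w = 1")
    case False
    have e: "\<psi> w - \<i> = 2 * \<i> / (w - 1)" by (simp add: \<psi>_def)
    have pos: "0 < norm (w - 1)" using False by simp
    have n: "norm (\<psi> w - \<i>) = 2 / norm (w - 1)" unfolding e by (simp add: norm_divide norm_mult)
    have "norm (G w) * norm (\<psi> w - \<i>) \<le> B"
      using decay[OF le[OF False w]] False by (simp add: G_def norm_mult norm_power mult_ac)
    then show ?thesis using pos unfolding n by (simp add: field_simps)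
  qed (simp add: G_def)
  have contG': "continuous_on (cball 0 1 - {1}) (\<lambda>w. g (\<psi> w) * (\<psi> w - \<i>) ^ (N + 1))"
  proof -
    have c\<psi>: "continuous_on (cball 0 1 - {1}) \<psi>" unfolding \<psi>_def by (intro continuous_intros) auto
    show ?thesis
      by (intro continuous_intros c\<psi> continuous_on_compose2[OF cont c\<psi>]) (use le in auto)
  qed
  then have contG'': "continuous_on (cball 0 1 - {1}) G"
    by (rule continuous_on_eq) (auto simp: G_def)
  have contG: "continuous_on (cball 0 1) G"
  proof -
    have "((\<lambda>w::complex. B / 2 * norm (w - 1)) \<longlongrightarrow> B / 2 * norm (1 - 1 :: complex)) (at 1 within cball 0 1)"
      by (intro tendsto_intros)
    then have "(G \<longlongrightarrow> 0) (at 1 within cball 0 1)"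
      by (intro Lim_null_comparison[of G "\<lambda>w. B / 2 * norm (w - 1)"])
         (use Gbound in \<open>auto simp: eventually_at_filter intro!: always_eventually\<close>)
    then have "continuous (at 1 within cball 0 1) G" by (simp add: continuous_within G_def)
    with contG'' show ?thesis by (rule continuous_on_if_punctured)
  qed
  have "(\<lambda>w. g (\<psi> w) * (\<psi> w - \<i>) ^ (N + 1)) holomorphic_on ball 0 1"
  proof -
    have h\<psi>: "\<psi> holomorphic_on ball 0 1" unfolding \<psi>_def by (intro holomorphic_intros) auto
    have "(g \<circ> \<psi>) holomorphic_on ball 0 1"
      by (intro holomorphic_on_compose_gen[OF h\<psi> hol]) (use lt in auto)
    then show ?thesis by (intro holomorphic_intros h\<psi>) (simp add: o_def)
  qed
  then have holG: "G holomorphic_on ball 0 1"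
    by (rule holomorphic_transform) (auto simp: G_def)
  obtain Q where Q: "\<And>w. w \<in> cball 0 1 \<Longrightarrow> norm (G w - poly Q w) \<le> \<eta>"
    using disc_algebra_polynomial_approx[OF contG holG \<eta>] by blast
  define P where "P = Q \<circ>\<^sub>p [:1, 2 * \<i>:]"
  define r where "r z = inverse (z - \<i>) ^ (N + 1) * poly P (inverse (z - \<i>))" for z
  have "norm (g z - r z) \<le> \<eta> * norm (inverse (z - \<i>) ^ (N + 1))" if z: "Im z < 0" for z
  proof -
    define w where "w = 1 + 2 * \<i> / (z - \<i>)"
    have zi: "z - \<i> \<noteq> 0" using z by auto
    have w1: "w \<noteq> 1" using zi by (simp add: w_def)
    have \<psi>w: "\<psi> w = z" using zi by (simp add: \<psi>_def w_def)
    have "norm w \<le> 1"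
    proof (rule ccontr)
      assume "\<not> norm w \<le> 1"
      then have "1 \<le> (norm w)\<^sup>2" by (simp add: one_le_power)
      then have "0 \<le> Im (\<psi> w)" unfolding Im\<psi>[OF w1] by simp
      then show False using z \<psi>w by simp
    qed
    then have "norm (G w - poly Q w) \<le> \<eta>" using Q[of w] by simp
    moreover have "G w = g z * (z - \<i>) ^ (N + 1)" using w1 by (simp add: G_def \<psi>w)
    moreover have "poly Q w = poly P (inverse (z - \<i>))"
      by (simp add: P_def poly_pcompose w_def divide_inverse mult_ac)
    ultimately have "norm (g z * (z - \<i>) ^ (N + 1) - poly P (inverse (z - \<i>))) \<le> \<eta>" by simp
    then have "norm (g z * (z - \<i>) ^ (N + 1) - poly P (inverse (z - \<i>))) * norm (inverse (z - \<i>) ^ (N + 1))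
        \<le> \<eta> * norm (inverse (z - \<i>) ^ (N + 1))" by (rule mult_right_mono) simp
    moreover have "g z - r z = (g z * (z - \<i>) ^ (N + 1) - poly P (inverse (z - \<i>))) * inverse (z - \<i>) ^ (N + 1)"
      using zi by (simp add: r_def left_diff_distrib power_inverse mult.commute[of "poly _ _"] del: power_Suc)
    ultimately show ?thesis by (simp only: norm_mult)
  qed
  moreover have "r \<in> rational_class N" unfolding rational_class_def r_def[abs_def] by blast
  ultimately show ?thesis by blast
qed

section \<open>Membership in the Hardy space and density\<close>

lemma nn_integral_powr_tail_finite:
  fixes s :: real
  assumes "1 < s"
  shows "(\<integral>\<^sup>+x. ennreal (max 1 \<bar>x\<bar> powr - s) \<partial>lborel) < top"
proof -
  have half: "(\<integral>\<^sup>+x. ennreal (indicator {1..} x * x powr - s) \<partial>lborel) = ennreal (- (1 powr (- s + 1)) / (- s + 1))"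
    by (rule nn_integral_has_integral_lebesgue[OF _ has_integral_powr_to_inf]) (use assms in auto)
  have refl: "(\<integral>\<^sup>+x. ennreal (indicator {1..} (- x) * (- x) powr - s) \<partial>lborel)
      = (\<integral>\<^sup>+x. ennreal (indicator {1..} x * x powr - s) \<partial>lborel)"
    using nn_integral_real_affine[of "\<lambda>x. ennreal (indicator {1..} x * x powr - s)" "-1" 0] by simp
  have "(\<integral>\<^sup>+x. ennreal (max 1 \<bar>x\<bar> powr - s) \<partial>lborel)
      \<le> (\<integral>\<^sup>+x. indicator {-1..1} x + 1 * ennreal (indicator {1..} x * x powr - s)
          + 1 * ennreal (indicator {1..} (- x) * (- x) powr - s) \<partial>lborel)"
  proof (rule nn_integral_mono)
    fix x :: real
    consider "x \<in> {-1..1}" | "1 < x" | "x < -1" by force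
    then show "ennreal (max 1 \<bar>x\<bar> powr - s) \<le> indicator {-1..1} x + 1 * ennreal (indicator {1..} x * x powr - s)
          + 1 * ennreal (indicator {1..} (- x) * (- x) powr - s)"
    proof cases
      case 1
      then have "max 1 \<bar>x\<bar> = 1" by auto
      then show ?thesis using 1 by (simp add: add.assoc)
    qed auto
  qed
  also have "\<dots> = (\<integral>\<^sup>+x. indicator {-1..1} (x :: real) \<partial>lborel)
      + 1 * (\<integral>\<^sup>+x. ennreal (indicator {1..} x * x powr - s) \<partial>lborel)
      + 1 * (\<integral>\<^sup>+x. ennreal (indicator {1..} (- x) * (- x) powr - s) \<partial>lborel)"
    by (rule nn_integral_lincomb) measurable
  also have "\<dots> < top" unfolding refl half by (simp add: ennreal_add_eq_top[symmetric] less_top)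
  finally show ?thesis .
qed

lemma line_mass_kernel_bound:
  assumes p: "0 < p" and Np: "1 < real (N + 1) * p"
  shows "\<exists>V\<ge>0. \<forall>y<0. line_mass p (\<lambda>z. inverse (z - \<i>) ^ (N + 1)) y \<le> ennreal V"
proof -
  define s where "s = real (N + 1) * p"
  define V where "V = enn2real (\<integral>\<^sup>+x. ennreal (max 1 \<bar>x\<bar> powr - s) \<partial>lborel)"
  have V: "(\<integral>\<^sup>+x. ennreal (max 1 \<bar>x\<bar> powr - s) \<partial>lborel) = ennreal V"
    using nn_integral_powr_tail_finite[of s] Np by (simp add: V_def s_def)
  have "line_mass p (\<lambda>z. inverse (z - \<i>) ^ (N + 1)) y \<le> ennreal V" if y: "y < 0" for y
    unfolding line_mass_def V[symmetric]
  proof (intro nn_integral_mono ennreal_leI)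
    fix x
    have ge: "max 1 \<bar>x\<bar> \<le> norm (Complex x y - \<i>)"
      using abs_Re_le_cmod[of "Complex x y - \<i>"] abs_Im_le_cmod[of "Complex x y - \<i>"] y by simp
    have "norm (inverse (Complex x y - \<i>) ^ (N + 1)) powr p = norm (Complex x y - \<i>) powr - s"
    proof -
      have pos: "0 < norm (Complex x y - \<i>)" using ge by linarith
      then have "norm (inverse (Complex x y - \<i>) ^ (N + 1)) = norm (Complex x y - \<i>) powr - real (N + 1)"
        by (simp only: norm_power norm_inverse powr_minus powr_realpow power_inverse)
      then show ?thesis by (simp only: powr_powr s_def mult_minus_left)
    qed
    also have "\<dots> \<le> max 1 \<bar>x\<bar> powr - s"
      using ge p by (intro powr_mono2') (auto simp: s_def)
    finally show "norm (inverse (Complex x y - \<i>) ^ (N + 1)) powr p \<le> max 1 \<bar>x\<bar> powr - s" .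
  qed
  then show ?thesis by (intro exI[of _ V]) (simp add: V_def)
qed

lemma line_mass_le_scale:
  assumes "0 < p" "0 \<le> A" "y < 0" "\<And>z. Im z < 0 \<Longrightarrow> norm (F z) \<le> A * norm (G z)"
    and G: "G holomorphic_on {z. Im z < 0}"
  shows "line_mass p F y \<le> ennreal (A powr p) * line_mass p G y"
proof -
  note [measurable] = measurable_line[OF G assms(1,3)]
  have le: "norm (F (Complex x y)) powr p \<le> A powr p * norm (G (Complex x y)) powr p" for x
  proof -
    have "norm (F (Complex x y)) powr p \<le> (A * norm (G (Complex x y))) powr p"
      using assms by (intro powr_mono2) auto
    then show ?thesis using assms by (simp add: powr_mult)
  qed
  have "line_mass p F y \<le> (\<integral>\<^sup>+x. ennreal (A powr p) * ennreal (norm (G (Complex x y)) powr p) \<partial>lborel)"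
    unfolding line_mass_def
    by (intro nn_integral_mono) (simp add: ennreal_mult'[symmetric] ennreal_leI le)
  also have "\<dots> = ennreal (A powr p) * line_mass p G y"
    unfolding line_mass_def by (simp add: nn_integral_cmult)
  finally show ?thesis .
qed

lemma line_integral_le:
  assumes hol: "F holomorphic_on {z. Im z < 0}" and p: "0 < p" and y: "y < 0"
    and le: "line_mass p F y \<le> ennreal K" and K: "0 \<le> K"
  shows "integrable lborel (\<lambda>x. norm (F (Complex x y)) powr p)" and "line_integral p F y \<le> K"
proof -
  have m: "(\<lambda>x. norm (F (Complex x y)) powr p) \<in> borel_measurable lborel"
    using measurable_line[OF hol p y] by simp
  show i: "integrable lborel (\<lambda>x. norm (F (Complex x y)) powr p)"
    by (rule integrableI_nonneg[OF m]) (use le in \<open>auto simp: line_mass_def order_le_less_trans\<close>)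
  have eq: "line_mass p F y = ennreal (line_integral p F y)"
    unfolding line_integral_def line_mass_def by (rule nn_integral_eq_integral[OF i]) simp
  show "line_integral p F y \<le> K" using le K unfolding eq by (simp add: ennreal_le_iff)
qed

text \<open>
  Translates between suprema of norms and uniform bounds on integrals over lines.
\<close>
lemma hardy_space_iff:
  assumes p: "0 < p"
  shows "f \<in> hardy_space p \<longleftrightarrow>
    f holomorphic_on {z. Im z < 0} \<and> (\<exists>K\<ge>0. \<forall>y<0. line_mass p f y \<le> ennreal K)"
proof safe
  assume f: "f \<in> hardy_space p"
  show "f holomorphic_on {z. Im z < 0}"
    using f by (simp add: hardy_space_def lower_half_plane_def)
  have int: "integrable lborel (\<lambda>x. norm (f (Complex x y)) powr p)" if "y < 0" for y
    using f that by (simp add: hardy_space_def)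
  obtain B where B: "\<And>y. y < 0 \<Longrightarrow> line_integral p f y powr (1 / p) \<le> B"
    using f by (auto simp: hardy_space_def bdd_above_def)
  have "line_mass p f y \<le> ennreal (B powr p)" if y: "y < 0" for y
  proof -
    have nonneg: "0 \<le> line_integral p f y" by (simp add: line_integral_def)
    have "(line_integral p f y powr (1 / p)) powr p \<le> B powr p"
      using B[OF y] p by (intro powr_mono2) auto
    then have "line_integral p f y \<le> B powr p" using p nonneg by (simp add: powr_powr)
    moreover have "line_mass p f y = ennreal (line_integral p f y)"
      unfolding line_integral_def line_mass_def by (rule nn_integral_eq_integral[OF int[OF y]]) simp
    ultimately show ?thesis by (simp add: ennreal_leI)
  qed
  then show "\<exists>K\<ge>0. \<forall>y<0. line_mass p f y \<le> ennreal K" by (intro exI[of _ "B powr p"]) simp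
next
  fix K assume hol: "f holomorphic_on {z. Im z < 0}" and K: "0 \<le> K" "\<forall>y<0. line_mass p f y \<le> ennreal K"
  have li: "integrable lborel (\<lambda>x. norm (f (Complex x y)) powr p)" "line_integral p f y \<le> K" if "y < 0" for y
    using line_integral_le[OF hol p that _ K(1)] K(2) that by auto
  have "line_integral p f y powr (1 / p) \<le> K powr (1 / p)" if "y < 0" for y
    using li(2)[OF that] p by (intro powr_mono2) (auto simp: line_integral_def)
  then show "f \<in> hardy_space p"
    using hol li(1) by (auto simp: hardy_space_def lower_half_plane_def bdd_above_def)
qed

text \<open>
  The two-case bound is the one that makes both versions of the distance at most \<open>\<epsilon> / 2\<close>; the
  supremum could attain the bound, hence the factor.
\<close>
lemma hardy_dist_less:
  assumes hol: "(\<lambda>z. f z - g z) holomorphic_on {z. Im z < 0}" and p: "0 < p" and \<epsilon>: "0 < \<epsilon>"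
    and le: "\<And>y. y < 0 \<Longrightarrow> line_mass p (\<lambda>z. f z - g z) y \<le> ennreal (if 1 \<le> p then (\<epsilon> / 2) powr p else \<epsilon> / 2)"
  shows "hardy_dist p f g < \<epsilon>"
proof -
  have li: "line_integral p (\<lambda>z. f z - g z) y \<le> (if 1 \<le> p then (\<epsilon> / 2) powr p else \<epsilon> / 2)" if "y < 0" for y
    by (rule line_integral_le(2)[OF hol p that le[OF that]]) (use \<epsilon> in auto)
  have "hardy_dist p f g \<le> \<epsilon> / 2"
  proof (cases "1 \<le> p")
    case True
    have "line_integral p (\<lambda>z. f z - g z) y powr (1 / p) \<le> \<epsilon> / 2" if "y < 0" for y
    proof -
      have "line_integral p (\<lambda>z. f z - g z) y powr (1 / p) \<le> ((\<epsilon> / 2) powr p) powr (1 / p)"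
        using li[OF that] True by (intro powr_mono2) (auto simp: line_integral_def)
      then show ?thesis using p \<epsilon> by (simp add: powr_powr)
    qed
    then have "hardy_norm p (\<lambda>z. f z - g z) \<le> \<epsilon> / 2"
      unfolding hardy_norm_def by (intro cSUP_least) auto
    then show ?thesis using True by (simp add: hardy_dist_def)
  next
    case False
    then have "(SUP y\<in>{..<0}. line_integral p (\<lambda>z. f z - g z) y) \<le> \<epsilon> / 2"
      using li by (intro cSUP_least) auto
    then show ?thesis using False by (simp add: hardy_dist_def)
  qed
  then show ?thesis using \<epsilon> by simp
qed

lemma rational_class_holomorphic: "r \<in> rational_class N \<Longrightarrow> r holomorphic_on {z. Im z < 0}"
  by (auto simp: rational_class_def intro!: holomorphic_intros)

lemma rational_class_subset_hardy_space:
  assumes p: "0 < p" and Np: "1 < real (N + 1) * p"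
  shows "rational_class N \<subseteq> hardy_space p"
proof
  fix r assume r: "r \<in> rational_class N"
  then obtain P where P: "r = (\<lambda>z. inverse (z - \<i>) ^ (N + 1) * poly P (inverse (z - \<i>)))"
    by (auto simp: rational_class_def)
  have "bounded (poly P ` cball 0 1)"
    by (intro compact_imp_bounded compact_continuous_image continuous_intros) simp
  then obtain B where B: "0 < B" "\<And>u. norm u \<le> 1 \<Longrightarrow> norm (poly P u) \<le> B"
    unfolding bounded_pos by force
  have le: "norm (r z) \<le> B * norm (inverse (z - \<i>) ^ (N + 1))" if "Im z < 0" for z
  proof -
    have "1 \<le> norm (z - \<i>)" using abs_Im_le_cmod[of "z - \<i>"] that by simp
    then have "norm (inverse (z - \<i>)) \<le> 1" by (simp add: norm_inverse inverse_le_1_iff)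
    then have "norm (poly P (inverse (z - \<i>))) \<le> B" by (rule B(2))
    then show ?thesis unfolding P norm_mult by (subst mult.commute) (rule mult_right_mono, auto)
  qed
  have khol: "(\<lambda>z. inverse (z - \<i>) ^ (N + 1)) holomorphic_on {z. Im z < 0}"
    by (auto intro!: holomorphic_intros)
  obtain V where V: "0 \<le> V" "\<And>y. y < 0 \<Longrightarrow> line_mass p (\<lambda>z. inverse (z - \<i>) ^ (N + 1)) y \<le> ennreal V"
    using line_mass_kernel_bound[OF p Np] by blast
  have "line_mass p r y \<le> ennreal (B powr p * V)" if y: "y < 0" for y
  proof -
    have "line_mass p r y \<le> ennreal (B powr p) * line_mass p (\<lambda>z. inverse (z - \<i>) ^ (N + 1)) y"
      by (rule line_mass_le_scale[OF p _ y le khol]) (use B in auto)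
    also have "\<dots> \<le> ennreal (B powr p) * ennreal V" by (intro mult_left_mono V y) simp
    finally show ?thesis by (simp add: ennreal_mult')
  qed
  then have "\<exists>K\<ge>0. \<forall>y<0. line_mass p r y \<le> ennreal K"
    using V(1) by (intro exI[of _ "B powr p * V"]) simp
  then show "r \<in> hardy_space p"
    using rational_class_holomorphic[OF r] by (simp add: hardy_space_iff[OF p])
qed

text \<open>
  Translate down, damp, and approximate rationally: \<open>f\<close>, \<open>h\<close>, \<open>g\<close>, \<open>r\<close> are successively close,
  and the quasi-triangle inequality with constant \<open>2 powr p\<close> is used twice.
\<close>
lemma rational_class_line_mass_approx:
  assumes p: "0 < p" and Np: "1 < real (N + 1) * p"
    and hol: "f holomorphic_on {z. Im z < 0}" and K: "\<And>y. y < 0 \<Longrightarrow> line_mass p f y \<le> ennreal K"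
    and \<eta>: "0 < \<eta>"
  shows "\<exists>r\<in>rational_class N. \<forall>y<0. line_mass p (\<lambda>z. f z - r z) y \<le> ennreal \<eta>"
proof -
  define a where "a = (2 :: real) powr p"
  define \<eta>1 where "\<eta>1 = \<eta> / (a * (1 + 2 * a))"
  have a: "0 < a" by (simp add: a_def)
  have \<eta>1: "0 < \<eta>1" using a \<eta> by (simp add: \<eta>1_def)
  obtain \<delta> where \<delta>: "0 < \<delta>"
    "\<And>y. y < 0 \<Longrightarrow> line_mass p (\<lambda>z. f z - f (z - \<i> * of_real \<delta>)) y \<le> ennreal \<eta>1"
    using translation_approx[OF hol p K \<eta>1] by blast
  define h where "h z = f (z - \<i> * of_real \<delta>)" for z
  have "(f \<circ> (\<lambda>z. z - \<i> * of_real \<delta>)) holomorphic_on {z. Im z < \<delta>}"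
    by (intro holomorphic_on_compose_gen[OF _ hol] holomorphic_intros) auto
  then have hhol: "h holomorphic_on {z. Im z < \<delta>}" by (simp add: h_def[abs_def] o_def)
  have hK: "line_mass p h y \<le> ennreal K" if "y < \<delta>" for y
    unfolding h_def[abs_def] line_mass_shift using K[of "y - \<delta>"] that by simp
  obtain \<epsilon> where \<epsilon>: "0 < \<epsilon>"
    "\<And>y. y < 0 \<Longrightarrow> line_mass p (\<lambda>z. h z - h z / (1 + \<i> * of_real \<epsilon> * z) ^ (N + 2)) y \<le> ennreal \<eta>1"
    using damping_approx[OF hhol \<delta>(1) p hK \<eta>1] by blast
  define g where "g z = h z / (1 + \<i> * of_real \<epsilon> * z) ^ (N + 2)" for z
  obtain B where B: "\<And>z. Im z \<le> 0 \<Longrightarrow> norm (h z) \<le> B"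
    using bounded_on_smaller_half_plane[OF hhol p hK \<delta>(1)] by blast
  have ge1: "1 \<le> norm (1 + \<i> * of_real \<epsilon> * z)" if "Im z \<le> 0" for z
  proof -
    have "1 \<le> Re (1 + \<i> * of_real \<epsilon> * z)" using that \<epsilon>(1) by (simp add: mult_nonneg_nonpos)
    then show ?thesis using complex_Re_le_cmod[of "1 + \<i> * of_real \<epsilon> * z"] by linarith
  qed
  \<comment> \<open>The damping factor has its pole at \<open>i / \<epsilon>\<close>, so \<open>|z - i|\<close> exceeds \<open>|1 + i \<epsilon> z| / \<epsilon> = |z - i / \<epsilon>|\<close>
    by at most \<open>1 + 1 / \<epsilon>\<close>.\<close>
  define L where "L = 1 / \<epsilon> + (1 + 1 / \<epsilon>)"
  have dist: "norm (z - \<i>) \<le> L * norm (1 + \<i> * of_real \<epsilon> * z)" if z: "Im z \<le> 0" for z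
  proof -
    have "z - \<i> = (1 + \<i> * of_real \<epsilon> * z) / (\<i> * of_real \<epsilon>) + (of_real (1 / \<epsilon>) - 1) * \<i>"
      using \<epsilon>(1) by (simp add: complex_eq_iff Re_divide Im_divide power2_eq_square field_simps)
    then have "norm (z - \<i>) \<le> norm ((1 + \<i> * of_real \<epsilon> * z) / (\<i> * of_real \<epsilon>)) + norm ((of_real (1 / \<epsilon>) - 1) * \<i>)"
      using norm_triangle_ineq by metis
    also have "norm ((1 + \<i> * of_real \<epsilon> * z) / (\<i> * of_real \<epsilon>)) = 1 / \<epsilon> * norm (1 + \<i> * of_real \<epsilon> * z)"
      using \<epsilon>(1) by (simp add: norm_divide norm_mult)
    also have "norm ((of_real (1 / \<epsilon>) - 1) * \<i>) \<le> (1 + 1 / \<epsilon>) * 1"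
      using norm_triangle_ineq4[of "of_real (1 / \<epsilon>)" "1::complex"] \<epsilon>(1) by (simp add: norm_mult norm_divide)
    also have "(1 + 1 / \<epsilon>) * 1 \<le> (1 + 1 / \<epsilon>) * norm (1 + \<i> * of_real \<epsilon> * z)"
      using \<epsilon>(1) ge1[OF z] by (intro mult_left_mono) auto
    finally show ?thesis by (simp add: L_def algebra_simps)
  qed
  have decay: "norm (g z) * norm (z - \<i>) ^ (N + 2) \<le> B * L ^ (N + 2)" if z: "Im z \<le> 0" for z
  proof -
    let ?d = "norm (1 + \<i> * of_real \<epsilon> * z)"
    have d: "0 < ?d" using ge1[OF z] by linarith
    have B0: "0 \<le> B" using B[OF z] norm_ge_zero[of "h z"] by linarith
    have "norm (g z) * norm (z - \<i>) ^ (N + 2) = norm (h z) * (norm (z - \<i>) / ?d) ^ (N + 2)"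
      unfolding g_def by (simp only: norm_divide norm_power power_divide) (simp only: times_divide_eq_left times_divide_eq_right)
    also have "\<dots> \<le> B * L ^ (N + 2)"
    proof (intro mult_mono power_mono)
      show "norm (z - \<i>) / ?d \<le> L" using dist[OF z] d by (simp add: pos_divide_le_eq)
    qed (use B[OF z] B0 in auto)
    finally show ?thesis .
  qed
  have nz: "1 + \<i> * of_real \<epsilon> * z \<noteq> 0" if "Im z \<le> 0" for z using ge1[OF that] by auto
  have gcont: "continuous_on {z. Im z \<le> 0} g"
    unfolding g_def
    by (intro continuous_intros continuous_on_subset[OF holomorphic_on_imp_continuous_on[OF hhol]])
       (use nz \<delta>(1) in auto)
  have hhol0: "h holomorphic_on {z. Im z < 0}"
    by (rule holomorphic_on_subset[OF hhol]) (use \<delta>(1) in auto)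
  have ghol: "g holomorphic_on {z. Im z < 0}"
    unfolding g_def by (intro holomorphic_intros hhol0) (use nz in auto)
  obtain V where V: "0 \<le> V" "\<And>y. y < 0 \<Longrightarrow> line_mass p (\<lambda>z. inverse (z - \<i>) ^ (N + 1)) y \<le> ennreal V"
    using line_mass_kernel_bound[OF p Np] by blast
  define \<kappa> where "\<kappa> = (\<eta>1 / (V + 1)) powr (1 / p)"
  have \<kappa>: "0 < \<kappa>" using \<eta>1 V by (simp add: \<kappa>_def)
  have \<kappa>V: "\<kappa> powr p * V \<le> \<eta>1"
  proof -
    have "\<kappa> powr p = \<eta>1 / (V + 1)" using p \<eta>1 V by (simp add: \<kappa>_def powr_powr)
    then show ?thesis using V(1) \<eta>1 by (simp only:) (simp add: field_simps)
  qed
  obtain r where r: "r \<in> rational_class N"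
    "\<And>z. Im z < 0 \<Longrightarrow> norm (g z - r z) \<le> \<kappa> * norm (inverse (z - \<i>) ^ (N + 1))"
    using rational_class_approx[OF gcont ghol decay \<kappa>] by blast
  have khol: "(\<lambda>z. inverse (z - \<i>) ^ (N + 1)) holomorphic_on {z. Im z < 0}"
    by (auto intro!: holomorphic_intros)
  note rhol = rational_class_holomorphic[OF r(1)]
  have "line_mass p (\<lambda>z. f z - r z) y \<le> ennreal \<eta>" if y: "y < 0" for y
  proof -
    have "line_mass p (\<lambda>z. g z - r z) y \<le> ennreal (\<kappa> powr p) * line_mass p (\<lambda>z. inverse (z - \<i>) ^ (N + 1)) y"
      by (rule line_mass_le_scale[OF p _ y r(2) khol]) (use \<kappa> in auto)
    also have "\<dots> \<le> ennreal (\<kappa> powr p) * ennreal V" by (intro mult_left_mono V y) simp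
    also have "\<dots> \<le> ennreal \<eta>1" using \<kappa>V by (simp add: ennreal_mult'[symmetric] ennreal_leI)
    finally have gr: "line_mass p (\<lambda>z. g z - r z) y \<le> ennreal \<eta>1" .
    have "line_mass p (\<lambda>z. h z - r z) y \<le> ennreal a * (line_mass p (\<lambda>z. h z - g z) y + line_mass p (\<lambda>z. g z - r z) y)"
    proof (rule line_mass_le_add[of _ 0])
      show "norm (h z - r z) powr p \<le> a * (norm (h z - g z) powr p + norm (g z - r z) powr p)" for z
        using norm_add_powr_le[OF p, of "h z - g z" "g z - r z"] by (simp add: a_def)
    qed (use a p y in \<open>auto intro!: holomorphic_intros hhol0 ghol rhol\<close>)
    also have "\<dots> \<le> ennreal a * (ennreal \<eta>1 + ennreal \<eta>1)"
      using \<epsilon>(2)[OF y] by (intro mult_left_mono add_mono gr) (simp_all add: g_def)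
    also have "\<dots> = ennreal (a * (2 * \<eta>1))"
      using a \<eta>1 by (simp add: ennreal_mult'[symmetric] ennreal_plus[symmetric] del: ennreal_plus)
    finally have hr: "line_mass p (\<lambda>z. h z - r z) y \<le> ennreal (a * (2 * \<eta>1))" .
    have "line_mass p (\<lambda>z. f z - r z) y \<le> ennreal a * (line_mass p (\<lambda>z. f z - h z) y + line_mass p (\<lambda>z. h z - r z) y)"
    proof (rule line_mass_le_add[of _ 0])
      show "norm (f z - r z) powr p \<le> a * (norm (f z - h z) powr p + norm (h z - r z) powr p)" for z
        using norm_add_powr_le[OF p, of "f z - h z" "h z - r z"] by (simp add: a_def)
    qed (use a p y in \<open>auto intro!: holomorphic_intros hhol0 hol rhol\<close>)
    also have "\<dots> \<le> ennreal a * (ennreal \<eta>1 + ennreal (a * (2 * \<eta>1)))"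
      using \<delta>(2)[OF y] by (intro mult_left_mono add_mono hr) (simp_all add: h_def)
    also have "\<dots> = ennreal (\<eta>1 * (a * (1 + 2 * a)))"
      using a \<eta>1 by (simp add: ennreal_mult'[symmetric] ennreal_plus[symmetric] algebra_simps del: ennreal_plus)
    also have "\<eta>1 * (a * (1 + 2 * a)) = \<eta>" using a by (simp add: \<eta>1_def)
    finally show ?thesis .
  qed
  then show ?thesis using r(1) by blast
qed

theorem corollary1:
  fixes N :: nat and p :: real
  assumes "0 < N" and "0 < p" and "real N * p > 1"
  shows "dense_in_hardy_space p (rational_class N)"
proof -
  note p = \<open>0 < p\<close>
  have Np: "1 < real (N + 1) * p" using assms by (simp add: distrib_right)
  have "\<exists>g\<in>rational_class N. hardy_dist p f g < \<epsilon>" if f: "f \<in> hardy_space p" and \<epsilon>: "0 < \<epsilon>" for f \<epsilon>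
  proof -
    obtain K where hol: "f holomorphic_on {z. Im z < 0}" and K: "\<And>y. y < 0 \<Longrightarrow> line_mass p f y \<le> ennreal K"
      using f unfolding hardy_space_iff[OF p] by blast
    define \<eta> where "\<eta> = (if 1 \<le> p then (\<epsilon> / 2) powr p else \<epsilon> / 2)"
    have \<eta>: "0 < \<eta>" using \<epsilon> by (simp add: \<eta>_def)
    obtain g where g: "g \<in> rational_class N" "\<And>y. y < 0 \<Longrightarrow> line_mass p (\<lambda>z. f z - g z) y \<le> ennreal \<eta>"
      using rational_class_line_mass_approx[OF p Np hol K \<eta>] by blast
    have "(\<lambda>z. f z - g z) holomorphic_on {z. Im z < 0}"
      by (intro holomorphic_intros hol rational_class_holomorphic[OF g(1)])
    then have "hardy_dist p f g < \<epsilon>"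
      by (rule hardy_dist_less[OF _ p \<epsilon>]) (use g(2) in \<open>simp add: \<eta>_def\<close>)
    then show ?thesis using g(1) by blast
  qed
  then show ?thesis
    using rational_class_subset_hardy_space[OF p Np] by (simp add: dense_in_hardy_space_def)
qed

end
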